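(* Let $F:I\times\mathbb{R}^n\rightrightarrows\mathbb{R}^n$ and $g:I^2\times\mathbb{R}^n\to\mathbb{R}^n$ satisfy the assumptions (F) and (g) stated in the context, let $\bar x(\cdot)$ be a solution of the integro-differential inclusion $$\dot x(t)\in F(t,x(t))+\int_0^t g(t,s,x(s))\,ds\ \text{ a.e. } t\in[0,T],\qquad x(0)=x_0,$$ and for each $k\in\mathbb{N}$ let $\Delta_k=\{0=t_0^k<t_1^k<\dots<t_k^k=T\}$ be a mesh with $h_j^k:=t_{j+1}^k-t_j^k$ and $\max_{0\le j\le k-1}h_j^k\le h_k:=T/k$. Then for every $k\in\mathbb{N}$ there exist a piecewise-linear function $x^k(\cdot)$ and a piecewise-constant function $y^k(\cdot)$ on $[0,T]$ such that $(x^k(0),y^k(0))=(x_0,0)$ and $$x^k(t)=x^k(t_j^k)+(t-t_j^k)v_j^k,\qquad y^k(t)=w_j^k\qquad\text{for } t\in(t_j^k,t_{j+1}^k],\ j=0,\dots,k-1,$$ where the vectors $v_j^k,w_j^k\in\mathbb{R}^n$ satisfy, for $j=0,\dots,k-1$, $$v_j^k\in F(t_j^k,x^k(t_j^k))+w_j^k,$$ $$w_j^k=\frac1{h_j^k}\int_{t_j^k}^{t_{j+1}^k}\Big\{\sum_{i=0}^{j-1}\int_{t_i^k}^{t_{i+1}^k}g(t,s,x^k(t_i^k))\,ds+\int_{t_j^k}^{t}g(t,s,x^k(t_j^k))\,ds\Big\}dt .$$ Moreover, as $k\to\infty$, $x^k(\cdot)\to\bar x(\cdot)$ in the norm topology of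 $W^{1,2}([0,T],\mathbb{R}^n)$ and $y^k(\cdot)\to\bar y(\cdot)$ in the norm topology of $L^2([0,T],\mathbb{R}^n)$, where $\bar y(t):=\int_0^t g(t,s,\bar x(s))\,ds$ for $t\in[0,T]$.
   Context: Here $T>0$, $I=[0,T]$, $x_0\in\mathbb{R}^n$, $\|\cdot\|$ is the Euclidean norm, $\mathbb{B}$ is the closed unit ball of $\mathbb{R}^n$ centered at $0$, and $Q_\Delta:=\{(t,s)\in I^2: s\le t\}$. Solutions (trajectories) of the inclusion are absolutely continuous functions $x:[0,T]\to\mathbb{R}^n$. (F) $F$ has nonempty closed values, $F(\cdot,x)$ is Hausdorff continuous (i.e. continuous with respect to the Pompeiu-Hausdorff metric) at a.e. $t\in I$ uniformly in $x\in\mathbb{R}^n$, and: (F1) there is a constant $m_F\ge0$ with $F(t,x)\subset m_F\mathbb{B}$ for all $t\in I$, $x\in\mathbb{R}^n$; (F2) there is a constant $l_F\ge0$ with $F(t,x_1)\subset F(t,x_2)+l_F\|x_1-x_2\|\mathbb{B}$ for all $x_1,x_2\in\mathbb{R}^n$, $t\in I$. (g) $g(\cdot,\cdot,x)$ is measurable on $I^2$ for each $x\in\mathbb{R}^n$, and: (g1) there is a constant $\beta\ge0$ with $\|g(t,s,x)\|\le\beta(1+\|x\|)$ for all $(t,s)\in Q_\Delta$, $x\in\mathbb{R}^n$; (g2) $x\mapsto g(t,s,x)$ is continuously differentiable for all $(t,s)\in I^2$, and for each $\eta>0$ there is a constant $\alpha\ge0$ with $\|\nabla g(t,s,x)\|\le\alpha$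 for all $(t,s)\in Q_\Delta$ and $x\in\eta\mathbb{B}$, where $\nabla g$ is the Jacobian with respect to $x$. *)

theory Defs
  imports "HOL-Analysis.Analysis"
begin

(* The epsilon-delta definition over finite families of non-overlapping subintervals [u,v]
   of [a,b]; a subinterval is encoded as the pair (u,v). *)
definition abs_continuous_on_interval ::
    "real \<Rightarrow> real \<Rightarrow> (real \<Rightarrow> 'a::real_normed_vector) \<Rightarrow> bool" where
  "abs_continuous_on_interval a b f \<longleftrightarrow>
     (\<forall>\<epsilon>>0. \<exists>\<delta>>0. \<forall>S :: (real \<times> real) set.
        finite S \<longrightarrow>
        (\<forall>(u, v) \<in> S. a \<le> u \<and> u \<le> v \<and> v \<le> b) \<longrightarrow>
        pairwise (\<lambda>p q. disjnt {fst p<..<snd p} {fst q<..<snd q}) S \<longrightarrow>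
        (\<Sum>(u, v) \<in> S. v - u) < \<delta> \<longrightarrow>
        (\<Sum>(u, v) \<in> S. norm (f v - f u)) < \<epsilon>)"

(* Pompeiu-Hausdorff distance. Real-valued suprema, so it is meaningful only for nonempty
   bounded sets; the values of F are nonempty, and bounded by (F1). *)
definition pompeiu_hausdorff :: "'a::metric_space set \<Rightarrow> 'a set \<Rightarrow> real" where
  "pompeiu_hausdorff A B = max (SUP a\<in>A. infdist a B) (SUP b\<in>B. infdist b A)"

definition in_L2 :: "real \<Rightarrow> (real \<Rightarrow> 'a::euclidean_space) \<Rightarrow> bool" where
  "in_L2 T f \<longleftrightarrow>
     f \<in> borel_measurable (lebesgue_on {0..T}) \<and>
     integrable (lebesgue_on {0..T}) (\<lambda>t. (norm (f t))\<^sup>2)"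

definition L2_norm :: "real \<Rightarrow> (real \<Rightarrow> 'a::euclidean_space) \<Rightarrow> real" where
  "L2_norm T f = sqrt (LINT t|lebesgue_on {0..T}. (norm (f t))\<^sup>2)"

definition L2_convergence ::
    "real \<Rightarrow> (nat \<Rightarrow> real \<Rightarrow> 'a::euclidean_space) \<Rightarrow> (real \<Rightarrow> 'a) \<Rightarrow> bool" where
  "L2_convergence T X x \<longleftrightarrow>
     in_L2 T x \<and> (\<forall>k\<ge>1. in_L2 T (X k)) \<and> (\<lambda>k. L2_norm T (\<lambda>t. X k t - x t)) \<longlonglongrightarrow> 0"

definition interval_deriv :: "real \<Rightarrow> (real \<Rightarrow> 'a::real_normed_vector) \<Rightarrow> real \<Rightarrow> 'a" where
  "interval_deriv T f t = vector_derivative f (at t within {0..T})"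

(* W^{1,2} in one dimension: the absolutely continuous functions with derivative in L^2.
   Where f is not differentiable (a null set) interval_deriv takes an arbitrary value. *)
definition in_W12 :: "real \<Rightarrow> (real \<Rightarrow> 'a::euclidean_space) \<Rightarrow> bool" where
  "in_W12 T f \<longleftrightarrow> abs_continuous_on_interval 0 T f \<and> in_L2 T (interval_deriv T f)"

definition W12_norm :: "real \<Rightarrow> (real \<Rightarrow> 'a::euclidean_space) \<Rightarrow> real" where
  "W12_norm T f = sqrt ((L2_norm T f)\<^sup>2 + (L2_norm T (interval_deriv T f))\<^sup>2)"

definition W12_convergence ::
    "real \<Rightarrow> (nat \<Rightarrow> real \<Rightarrow> 'a::euclidean_space) \<Rightarrow> (real \<Rightarrow> 'a) \<Rightarrow> bool" where
  "W12_convergence T X x \<longleftrightarrow>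
     in_W12 T x \<and> (\<forall>k\<ge>1. in_W12 T (X k)) \<and> (\<lambda>k. W12_norm T (\<lambda>t. X k t - x t)) \<longlonglongrightarrow> 0"

definition assumption_F :: "real \<Rightarrow> (real \<Rightarrow> real ^ 'n \<Rightarrow> (real ^ 'n) set) \<Rightarrow> bool" where
  "assumption_F T F \<longleftrightarrow>
     (\<forall>t\<in>{0..T}. \<forall>x. F t x \<noteq> {} \<and> closed (F t x)) \<and>
     (AE t in lebesgue_on {0..T}.
        \<forall>\<epsilon>>0. \<exists>\<delta>>0. \<forall>t'\<in>{0..T}. \<bar>t' - t\<bar> < \<delta> \<longrightarrow>
          (\<forall>x. pompeiu_hausdorff (F t' x) (F t x) < \<epsilon>)) \<and>
     (\<exists>m\<ge>0. \<forall>t\<in>{0..T}. \<forall>x. F t x \<subseteq> cball 0 m) \<and>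
     (\<exists>l\<ge>0. \<forall>t\<in>{0..T}. \<forall>x1 x2. F t x1 \<subseteq> F t x2 + cball 0 (l * norm (x1 - x2)))"

definition assumption_g :: "real \<Rightarrow> (real \<Rightarrow> real \<Rightarrow> real ^ 'n \<Rightarrow> real ^ 'n) \<Rightarrow> bool" where
  "assumption_g T g \<longleftrightarrow>
     (\<forall>x. (\<lambda>(t, s). g t s x) \<in> borel_measurable (lebesgue_on ({0..T} \<times> {0..T}))) \<and>
     (\<exists>\<beta>\<ge>0. \<forall>t\<in>{0..T}. \<forall>s\<in>{0..t}. \<forall>x. norm (g t s x) \<le> \<beta> * (1 + norm x)) \<and>
     (\<forall>t\<in>{0..T}. \<forall>s\<in>{0..T}.
        (\<forall>x. g t s differentiable (at x)) \<and>
        continuous_on UNIV (\<lambda>x. jacobian (g t s) (at x))) \<and>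
     (\<forall>\<eta>>0. \<exists>\<alpha>\<ge>0. \<forall>t\<in>{0..T}. \<forall>s\<in>{0..t}. \<forall>x\<in>cball 0 \<eta>.
        onorm ((*v) (jacobian (g t s) (at x))) \<le> \<alpha>)"

(* All integrals below are Bochner integrals for the completed Lebesgue measure, since
   g is only assumed Lebesgue measurable in (t,s). *)
definition memory_term ::
    "(real \<Rightarrow> real \<Rightarrow> real ^ 'n \<Rightarrow> real ^ 'n) \<Rightarrow> (real \<Rightarrow> real ^ 'n) \<Rightarrow> real \<Rightarrow> real ^ 'n" where
  "memory_term g x t = (LINT s:{0..t}|lebesgue. g t s (x s))"

definition is_solution ::
    "real \<Rightarrow> (real \<Rightarrow> real ^ 'n \<Rightarrow> (real ^ 'n) set) \<Rightarrow>
     (real \<Rightarrow> real \<Rightarrow> real ^ 'n \<Rightarrow> real ^ 'n) \<Rightarrow> real ^ 'n \<Rightarrow> (real \<Rightarrow> real ^ 'n) \<Rightarrow> bool" where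
  "is_solution T F g x0 x \<longleftrightarrow>
     abs_continuous_on_interval 0 T x \<and> x 0 = x0 \<and>
     (AE t in lebesgue_on {0..T}. \<exists>u\<in>F t (x t).
        (x has_vector_derivative (u + memory_term g x t)) (at t within {0..T}))"

(* A mesh 0 = \<tau> 0 < ... < \<tau> k = T; only the values \<tau> 0, ..., \<tau> k matter. *)
definition is_mesh :: "real \<Rightarrow> nat \<Rightarrow> (nat \<Rightarrow> real) \<Rightarrow> bool" where
  "is_mesh T k \<tau> \<longleftrightarrow>
     \<tau> 0 = 0 \<and> \<tau> k = T \<and>
     (\<forall>j<k. \<tau> j < \<tau> (Suc j) \<and> \<tau> (Suc j) - \<tau> j \<le> T / real k)"

(* x is the piecewise-linear and y the piecewise-constant function of the scheme on the mesh
   \<tau> with k cells, with slopes v j and values w j on the half-open cells. *)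
definition is_discrete_approximation ::
    "(real \<Rightarrow> real ^ 'n \<Rightarrow> (real ^ 'n) set) \<Rightarrow> (real \<Rightarrow> real \<Rightarrow> real ^ 'n \<Rightarrow> real ^ 'n) \<Rightarrow>
     real ^ 'n \<Rightarrow> nat \<Rightarrow> (nat \<Rightarrow> real) \<Rightarrow>
     (real \<Rightarrow> real ^ 'n) \<Rightarrow> (real \<Rightarrow> real ^ 'n) \<Rightarrow>
     (nat \<Rightarrow> real ^ 'n) \<Rightarrow> (nat \<Rightarrow> real ^ 'n) \<Rightarrow> bool" where
  "is_discrete_approximation F g x0 k \<tau> x y v w \<longleftrightarrow>
     x 0 = x0 \<and> y 0 = 0 \<and>
     (\<forall>j<k. \<forall>t\<in>{\<tau> j<..\<tau> (Suc j)}. x t = x (\<tau> j) + (t - \<tau> j) *\<^sub>R v j \<and> y t = w j) \<and>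
     (\<forall>j<k. \<exists>u\<in>F (\<tau> j) (x (\<tau> j)). v j = u + w j) \<and>
     (\<forall>j<k. w j = (1 / (\<tau> (Suc j) - \<tau> j)) *\<^sub>R
        (LINT t:{\<tau> j..\<tau> (Suc j)}|lebesgue.
           (\<Sum>i<j. LINT s:{\<tau> i..\<tau> (Suc i)}|lebesgue. g t s (x (\<tau> i))) +
           (LINT s:{\<tau> j..t}|lebesgue. g t s (x (\<tau> j)))))"

end

(*
  A mesh with k cells of length at most T/k is uniform, so only the grid j T/k occurs.
  Write xbar' = ubar + ybar with ubar(t) in F(t, xbar(t)) a.e.  The scheme chooses in each cell
  the point u_j of F(t_j, x_j) closest to the mean of ubar over the cell.  Since F need not be
  convex, these means do not lie near F; but for a.e. t in the cell ubar(t) lies near F(t_j, x_j)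
  by continuity in t and Lipschitz continuity in x, and the means converge to ubar in L^1, so
  the u_j do as well, up to a multiple of the position error.  A discrete Gronwall
  inequality then makes the position error at the nodes vanish, the memory terms converge
  because g is Lipschitz on bounded sets, and L^1 convergence of uniformly bounded velocities is
  L^2 convergence.
*)
theory Submission
  imports Defs
begin

section \<open>Absolutely continuous functions and the fundamental theorem of calculus\<close>

hide_const (open) Polynomial.content

text \<open>Several data are available only up to null sets: \<open>F\<close> is continuous in time
  and \<open>xbar\<close> differentiable almost everywhere, and at exceptional times the integrand
  of the memory term may be nonmeasurable. Therefore bounds are arranged to hold at every time,
  default values included, while identities are claimed off a negligible set. The selection
  \<open>ubar\<close> is picked pointwise by choice; its measurability comes from the fundamental
  theorem in Henstock-Kurzweil form, where integrability of the derivative of \<open>xbar\<close> is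
  a conclusion. Each \<open>w j\<close> is the cell mean of the memory term of the step function
  through the nodes, so memory and velocity errors are both handled by averaging over cells. Since
  \<open>g\<close> is Lipschitz only on balls, the scheme must first be bounded independently of
  \<open>k\<close>; that bound fixes the ball on which the Lipschitz constant is taken.\<close>

lemma abs_continuousE:
  assumes "abs_continuous_on_interval a b f" "e > 0"
  obtains \<delta> where "\<delta> > 0" "\<And>S :: (real \<times> real) set.
        finite S \<Longrightarrow> (\<forall>(u, v) \<in> S. a \<le> u \<and> u \<le> v \<and> v \<le> b) \<Longrightarrow>
        pairwise (\<lambda>p q. disjnt {fst p<..<snd p} {fst q<..<snd q}) S \<Longrightarrow>
        (\<Sum>(u, v) \<in> S. v - u) < \<delta> \<Longrightarrow> (\<Sum>(u, v) \<in> S. norm (f v - f u)) < e"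
  using assms(1)[unfolded abs_continuous_on_interval_def, THEN spec, THEN mp, OF assms(2)]
  by (elim exE conjE) blast

text \<open>The cells of a fine tagged division are split by their tags. For a tag outside
  \<open>N\<close>, differentiability makes the error of the cell at most \<open>c\<close> times its
  length. Cells tagged in \<open>N\<close> lie in an open set of measure below \<delta>, so absolute
  continuity bounds the sum of their increments. Integrability of \<open>D\<close> is part of the
  conclusion.\<close>

lemma abs_continuous_fundamental_theorem:
  fixes f :: "real \<Rightarrow> 'a::banach"
  assumes ac: "abs_continuous_on_interval a b f" and ab: "a \<le> b"
    and N: "negligible N"
    and der: "\<And>t. t \<in> {a..b} - N \<Longrightarrow> (f has_vector_derivative D t) (at t within {a..b})"
  shows "(D has_integral f b - f a) {a..b}"
proof (rule has_integral_spike[OF N])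
  let ?D = "\<lambda>t. if t \<in> N then 0 else D t"
  show "D t = ?D t" if "t \<in> {a..b} - N" for t
    using that by simp
  show "(?D has_integral f b - f a) {a..b}"
    unfolding has_integral_real
  proof (intro allI impI)
    fix e :: real assume e: "e > 0"
    \<comment> \<open>The added 1 keeps the denominator positive when \<open>a = b\<close> and makes
      \<open>c * (b - a) < e / 2\<close> strict.\<close>
    define c where "c = e / (2 * (b - a + 1))"
    have c: "c > 0" using e ab by (simp add: c_def)
    obtain \<delta> where \<delta>: "\<delta> > 0" and ac\<delta>: "\<And>S :: (real \<times> real) set.
        finite S \<Longrightarrow> (\<forall>(u, v) \<in> S. a \<le> u \<and> u \<le> v \<and> v \<le> b) \<Longrightarrow>
        pairwise (\<lambda>p q. disjnt {fst p<..<snd p} {fst q<..<snd q}) S \<Longrightarrow>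
        (\<Sum>(u, v) \<in> S. v - u) < \<delta> \<Longrightarrow> (\<Sum>(u, v) \<in> S. norm (f v - f u)) < e / 2"
      using abs_continuousE[OF ac half_gt_zero[OF e]] by blast
    obtain U where U: "open U" "N \<subseteq> U" "U - N \<in> lmeasurable" "emeasure lebesgue (U - N) < ennreal \<delta>"
      using sets_lebesgue_outer_open[OF negligible_imp_sets[OF N] \<delta>] by blast
    have Um: "U \<in> lmeasurable"
      using fmeasurable.Un[OF U(3) negligible_imp_measurable[OF N]] U(2)
      by (simp add: Un_absorb2)
    have "measure lebesgue U = measure lebesgue (U - N)"
      using measure_Diff_null_set[of U lebesgue N] N Um negligible_iff_null_sets fmeasurableD
      by metis
    also have "\<dots> < \<delta>"
      using U(3,4) \<delta> by (simp add: emeasure_eq_measure2 ennreal_less_iff)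
    finally have U\<delta>: "measure lebesgue U < \<delta>" .
    have "\<forall>t. \<exists>d>0. t \<in> {a..b} - N \<longrightarrow>
         (\<forall>y\<in>{a..b}. norm (y-t) < d \<longrightarrow> norm (f y - f t - (y-t) *\<^sub>R D t) \<le> c * norm (y-t))"
      using der c unfolding has_vector_derivative_def has_derivative_within_alt by blast
    then obtain d where d0: "\<And>t. d t > 0"
      and d: "\<And>t y. t \<in> {a..b} - N \<Longrightarrow> y \<in> {a..b} \<Longrightarrow> norm (y-t) < d t \<Longrightarrow>
            norm (f y - f t - (y-t) *\<^sub>R D t) \<le> c * norm (y-t)"
      by metis
    define \<gamma> where "\<gamma> t = (if t \<in> N then U else ball t (d t))" for t
    have \<gamma>: "gauge \<gamma>"
      using U(1,2) d0 by (auto simp: gauge_def \<gamma>_def)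
    show "\<exists>\<gamma>. gauge \<gamma> \<and> (\<forall>\<D>. \<D> tagged_division_of {a..b} \<and> \<gamma> fine \<D> \<longrightarrow>
        norm (sum (\<lambda>(x,k). content k *\<^sub>R ?D x) \<D> - (f b - f a)) < e)"
    proof (intro exI[of _ \<gamma>] conjI allI impI \<gamma>)
      fix p assume "p tagged_division_of {a..b} \<and> \<gamma> fine p"
      then have p: "p tagged_division_of {a..b}" "\<gamma> fine p" by simp_all
      have finp: "finite p" using p(1) by (rule tagged_division_of_finite)
      let ?E = "\<lambda>(x,k). content k *\<^sub>R ?D x - (f (Sup k) - f (Inf k))"
      have cell: "\<exists>u v. k = {u..v} \<and> u \<le> x \<and> x \<le> v \<and> a \<le> u \<and> v \<le> b" if xk: "(x,k) \<in> p" for x k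
      proof -
        obtain u v where "k = cbox u v" using tagged_division_ofD(4)[OF p(1) xk] by blast
        moreover have "x \<in> k" "k \<subseteq> {a..b}"
          using tagged_division_ofD(2,3)[OF p(1) xk] by auto
        ultimately show ?thesis by auto
      qed
      \<comment> \<open>Degenerate cells go into \<open>Z\<close>: the cells of \<open>B\<close>
        then have nonempty interiors, which is what makes \<open>?h\<close> injective on
        \<open>B\<close>.\<close>
      define G where "G = {q \<in> p. fst q \<notin> N}"
      define B where "B = {q \<in> p. fst q \<in> N \<and> content (snd q) \<noteq> 0}"
      define Z where "Z = {q \<in> p. fst q \<in> N \<and> content (snd q) = 0}"
      have part: "p = G \<union> (B \<union> Z)" "G \<inter> (B \<union> Z) = {}" "B \<inter> Z = {}"
        and fin: "finite G" "finite B" "finite Z"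
        using finp by (auto simp: G_def B_def Z_def)
      have "sum (\<lambda>(x,k). content k *\<^sub>R ?D x) p - (f b - f a) = sum ?E p"
        using additive_tagged_division_1[OF ab p(1), of f]
        by (simp add: sum_subtractf case_prod_beta)
      also have "\<dots> = sum ?E G + (sum ?E B + sum ?E Z)"
        unfolding part(1) using part(2,3) fin
        by (simp add: sum.union_disjoint[of G "B \<union> Z"] sum.union_disjoint[of B Z])
      also have "sum ?E Z = 0"
      proof (rule sum.neutral, clarify)
        fix x k assume "(x,k) \<in> Z"
        then have "(x,k) \<in> p" "content k = 0" by (auto simp: Z_def)
        with cell obtain u v where "k = {u..v}" "u \<le> x" "x \<le> v" by blast
        with \<open>content k = 0\<close> show "content k *\<^sub>R ?D x - (f (Sup k) - f (Inf k)) = 0" by simp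
      qed
      finally have eq: "sum (\<lambda>(x,k). content k *\<^sub>R ?D x) p - (f b - f a) = sum ?E G + sum ?E B"
        by simp
      have "norm (sum ?E G) \<le> (\<Sum>(x,k)\<in>G. c * content k)"
      proof (rule sum_norm_le, clarify)
        fix x k assume xk: "(x,k) \<in> G"
        then have xp: "(x,k) \<in> p" and xN: "x \<notin> N" by (auto simp: G_def)
        then obtain u v where k: "k = {u..v}" "u \<le> x" "x \<le> v" "a \<le> u" "v \<le> b" using cell by blast
        have "k \<subseteq> ball x (d x)" using fineD[OF p(2) xp] xN by (simp add: \<gamma>_def)
        then have "u \<in> ball x (d x)" "v \<in> ball x (d x)"
          using k by force+
        then have uv: "norm (u - x) < d x" "norm (v - x) < d x"
          using k by (force simp: dist_norm)+
        have "norm (f u - f x - (u - x) *\<^sub>R D x) \<le> c * norm (u - x)"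
          "norm (f v - f x - (v - x) *\<^sub>R D x) \<le> c * norm (v - x)"
          using d[of x u] d[of x v] uv k xN by auto
        moreover have "content k *\<^sub>R ?D x - (f (Sup k) - f (Inf k)) =
            (f u - f x - (u - x) *\<^sub>R D x) - (f v - f x - (v - x) *\<^sub>R D x)"
          using k xN by (simp add: algebra_simps)
        moreover have "c * norm (u - x) + c * norm (v - x) = c * content k"
          using k by (simp add: algebra_simps)
        ultimately show "norm (content k *\<^sub>R ?D x - (f (Sup k) - f (Inf k))) \<le> c * content k"
          by (smt (verit) norm_triangle_ineq4)
      qed
      also have "\<dots> \<le> (\<Sum>(x,k)\<in>p. c * content k)"
        using finp c by (intro sum_mono2) (auto simp: G_def)
      also have "\<dots> = c * (b - a)"
        using additive_content_tagged_division[of p a b] p(1) ab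
        by (simp add: sum_distrib_left[symmetric] case_prod_beta)
      also have "\<dots> < e / 2"
        using e ab by (simp add: c_def field_simps)
      finally have 1: "norm (sum ?E G) < e / 2" .
      let ?h = "\<lambda>(x,k::real set). (Inf k, Sup k)"
      have Bcell: "\<exists>u v. k = {u..v} \<and> u < v \<and> a \<le> u \<and> v \<le> b \<and> k \<subseteq> U" if "(x,k) \<in> B" for x k
      proof -
        have xk: "(x,k) \<in> p" "x \<in> N" "content k \<noteq> 0" using that by (auto simp: B_def)
        have "k \<subseteq> U" using fineD[OF p(2) xk(1)] xk(2) by (simp add: \<gamma>_def)
        moreover obtain u v where "k = {u..v}" "u \<le> x" "x \<le> v" "a \<le> u" "v \<le> b"
          using cell xk by blast
        moreover have "u \<noteq> v" using xk(3) \<open>k = {u..v}\<close> by auto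
        ultimately show ?thesis by force
      qed
      have Bint: "interior k1 \<inter> interior k2 = {}" if "(x1,k1) \<in> B" "(x2,k2) \<in> B" "(x1,k1) \<noteq> (x2,k2)"
        for x1 k1 x2 k2
        using tagged_division_ofD(5)[OF p(1), of x1 k1 x2 k2] that by (simp add: B_def)
      have inj: "inj_on ?h B"
      proof (rule inj_onI, clarify)
        fix x1 k1 x2 k2
        assume *: "(x1,k1) \<in> B" "(x2,k2) \<in> B" "Inf k1 = Inf k2" "Sup k1 = Sup k2"
        then have "k1 = k2" "interior k1 \<noteq> {}" using Bcell[OF *(1)] Bcell[OF *(2)] by auto
        then show "x1 = x2 \<and> k1 = k2" using Bint[OF *(1,2)] by blast
      qed
      have disj: "pairwise (\<lambda>p q. disjnt {fst p<..<snd p} {fst q<..<snd q}) (?h ` B)"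
      proof (rule pairwiseI)
        fix q1 q2 assume q: "q1 \<in> ?h ` B" "q2 \<in> ?h ` B" "q1 \<noteq> q2"
        then obtain x1 k1 x2 k2 where *: "(x1,k1) \<in> B" "(x2,k2) \<in> B"
          and eq: "q1 = (Inf k1, Sup k1)" "q2 = (Inf k2, Sup k2)"
          by auto
        with q(3) have "(x1,k1) \<noteq> (x2,k2)" by auto
        from Bint[OF *(1,2) this]
        show "disjnt {fst q1<..<snd q1} {fst q2<..<snd q2}"
          using Bcell[OF *(1)] Bcell[OF *(2)] by (auto simp: disjnt_def eq)
      qed
      have "(\<Sum>(u, v) \<in> ?h ` B. v - u) = (\<Sum>q\<in>?h ` B. measure lebesgue {fst q<..<snd q})"
        by (rule sum.cong[OF refl]) (use Bcell in fastforce)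
      also have "\<dots> = measure lebesgue (\<Union>q\<in>?h ` B. {fst q<..<snd q})"
        using fin(2) disj by (intro measure_UNION'[symmetric]) auto
      also have "\<dots> \<le> measure lebesgue U"
      proof (rule measure_mono_fmeasurable[OF _ _ Um])
        show "(\<Union>q\<in>?h ` B. {fst q<..<snd q}) \<subseteq> U"
          using Bcell by fastforce
        show "(\<Union>q\<in>?h ` B. {fst q<..<snd q}) \<in> sets lebesgue"
          using fin(2) by (intro sets.finite_UN) auto
      qed
      also have "\<dots> < \<delta>" by (rule U\<delta>)
      finally have "(\<Sum>(u, v) \<in> ?h ` B. norm (f v - f u)) < e / 2"
        using fin(2) disj Bcell by (intro ac\<delta>) fastforce+
      then have 2: "(\<Sum>(x,k)\<in>B. norm (f (Sup k) - f (Inf k))) < e / 2"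
        by (simp add: sum.reindex[OF inj, unfolded case_prod_beta] case_prod_beta)
      have "norm (sum ?E B) \<le> (\<Sum>(x,k)\<in>B. norm (f (Sup k) - f (Inf k)))"
        by (rule sum_norm_le) (auto simp: B_def norm_minus_commute)
      with 1 2 eq show "norm (sum (\<lambda>(x,k). content k *\<^sub>R ?D x) p - (f b - f a)) < e"
        using norm_triangle_ineq[of "sum ?E G" "sum ?E B"] by simp
    qed
  qed
qed

section \<open>Uniform meshes and cell means\<close>

definition grid :: "real \<Rightarrow> nat \<Rightarrow> nat \<Rightarrow> real" where
  "grid T k j = real j * (T / real k)"

text \<open>Cells are half-open on the left, as in the scheme; at t = 0 the truncation by nat yields cell 0.\<close>
definition cell_index :: "real \<Rightarrow> nat \<Rightarrow> real \<Rightarrow> nat" where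
  "cell_index T k t = nat (\<lceil>t * real k / T\<rceil> - 1)"

definition cell_mean :: "real \<Rightarrow> nat \<Rightarrow> (real \<Rightarrow> 'a::euclidean_space) \<Rightarrow> nat \<Rightarrow> 'a" where
  "cell_mean T k f j = (real k / T) *\<^sub>R integral {grid T k j..grid T k (Suc j)} f"

lemma grid_0 [simp]: "grid T k 0 = 0"
  by (simp add: grid_def)

lemma grid_last [simp]: "k \<ge> 1 \<Longrightarrow> grid T k k = T"
  by (simp add: grid_def)

lemma grid_Suc: "grid T k (Suc j) = grid T k j + T / real k"
  by (simp add: grid_def algebra_simps add_divide_distrib)

lemma grid_mono: "T > 0 \<Longrightarrow> i \<le> j \<Longrightarrow> grid T k i \<le> grid T k j"
  by (simp add: grid_def divide_right_mono mult_right_mono)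

lemma grid_nonneg: "T > 0 \<Longrightarrow> 0 \<le> grid T k j"
  by (simp add: grid_def)

lemma grid_le: "T > 0 \<Longrightarrow> k \<ge> 1 \<Longrightarrow> j \<le> k \<Longrightarrow> grid T k j \<le> T"
  using grid_mono[of T j k k] by simp

lemma cell_subset: "T > 0 \<Longrightarrow> j < k \<Longrightarrow> {grid T k j..grid T k (Suc j)} \<subseteq> {0..T}"
  using grid_nonneg[of T k j] grid_le[of T k "Suc j"] by auto

text \<open>The \<open>k\<close> cell lengths add up to \<open>T\<close> and none exceeds
  \<open>T / real k\<close>. Summing from the left bounds a node from above, summing from the right
  bounds it from below, and the two bounds coincide.\<close>

lemma mesh_eq_grid:
  assumes m: "is_mesh T k \<tau>" and k: "k \<ge> 1" and j: "j \<le> k"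
  shows "\<tau> j = grid T k j"
proof -
  have step: "\<tau> (Suc i) - \<tau> i \<le> T / real k" if "i < k" for i
    using m that by (auto simp: is_mesh_def)
  have le: "\<tau> i \<le> grid T k i" if "i \<le> k" for i
    using that
  proof (induction i)
    case 0 then show ?case using m by (simp add: is_mesh_def)
  next
    case (Suc i) then show ?case using step[of i] by (simp add: grid_Suc)
  qed
  have ge: "T - \<tau> (k - i) \<le> grid T k i" if "i \<le> k" for i
    using that
  proof (induction i)
    case 0 then show ?case using m by (simp add: is_mesh_def)
  next
    case (Suc i) then show ?case using step[of "k - Suc i"] by (simp add: grid_Suc Suc_diff_Suc)
  qed
  have "grid T k j + grid T k (k - j) = T"
    using j k by (simp add: grid_def of_nat_diff field_simps)
  then show ?thesis
    using le[OF j] ge[of "k - j"] j by simp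
qed

lemma cell_index_eq:
  assumes "T > 0" "k \<ge> 1" "grid T k j < t" "t \<le> grid T k (Suc j)"
  shows "cell_index T k t = j"
proof -
  have "real j < t * real k / T" "t * real k / T \<le> real j + 1"
    using assms by (auto simp: grid_def field_simps)
  then have "\<lceil>t * real k / T\<rceil> = int j + 1" by (intro ceiling_unique) auto
  then show ?thesis by (simp add: cell_index_def)
qed

lemma cell_index_0 [simp]: "cell_index T k 0 = 0"
  by (simp add: cell_index_def)

lemma cell_index_bounds:
  assumes "T > 0" "k \<ge> 1" "0 < t" "t \<le> T"
  shows "cell_index T k t < k" "grid T k (cell_index T k t) < t" "t \<le> grid T k (Suc (cell_index T k t))"
proof -
  define c where "c = \<lceil>t * real k / T\<rceil>"
  have "0 < t * real k / T" "t * real k / T \<le> real k" using assms by (auto simp: field_simps)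
  then have c: "c \<ge> 1" "c \<le> int k" unfolding c_def by (auto simp: ceiling_le_iff)
  then have ci: "real (cell_index T k t) = real_of_int c - 1" "cell_index T k t < k"
    by (auto simp: cell_index_def c_def[symmetric])
  show "cell_index T k t < k" by (rule ci)
  have "real_of_int c - 1 < t * real k / T" "t * real k / T \<le> real_of_int c"
    unfolding c_def by linarith+
  then have "real (cell_index T k t) < t * real k / T" "t * real k / T \<le> real (cell_index T k t) + 1"
    using ci(1) by linarith+
  then show "grid T k (cell_index T k t) < t" "t \<le> grid T k (Suc (cell_index T k t))"
    using assms by (auto simp: grid_def field_simps)
qed

lemma cell_index_less:
  assumes "T > 0" "k \<ge> 1" "t \<in> {0..T}"
  shows "cell_index T k t < k" "t \<in> {grid T k (cell_index T k t)..grid T k (Suc (cell_index T k t))}"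
  using cell_index_bounds[of T k t] assms by (cases "t = 0"; force simp: grid_def)+

lemma integral_cells:
  fixes f :: "real \<Rightarrow> 'a::banach"
  assumes T: "T > 0" and f: "f integrable_on {0..grid T k n}"
  shows "integral {0..grid T k n} f = (\<Sum>j<n. integral {grid T k j..grid T k (Suc j)} f)"
  using f
proof (induction n)
  case (Suc n)
  have "f integrable_on {0..grid T k n}"
    using T by (intro integrable_subinterval_real[OF Suc.prems]) (auto simp: grid_mono)
  moreover have "integral {0..grid T k n} f + integral {grid T k n..grid T k (Suc n)} f = integral {0..grid T k (Suc n)} f"
    using T Suc.prems by (intro Henstock_Kurzweil_Integration.integral_combine) (auto simp: grid_nonneg grid_mono)
  ultimately show ?case using Suc.IH by simp
qed simp

lemma borel_measurable_cell_index [measurable]: "(\<lambda>t. a (cell_index T k t)) \<in> borel_measurable borel"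
proof -
  have "(\<lambda>t. cell_index T k t) \<in> borel \<rightarrow>\<^sub>M count_space UNIV"
    unfolding cell_index_def by measurable
  then show ?thesis by measurable
qed

section \<open>Integrals of bounded measurable functions and of step functions\<close>

lemma bounded_measurable_absolutely_integrable:
  fixes f :: "real \<Rightarrow> 'a::euclidean_space"
  assumes "f \<in> borel_measurable (lebesgue_on {a..b})" "\<And>t. t \<in> {a..b} \<Longrightarrow> norm (f t) \<le> B"
  shows "f absolutely_integrable_on {a..b}"
  using assms by (intro measurable_bounded_by_integrable_imp_absolutely_integrable[where g="\<lambda>_. B"]) auto

lemma borel_measurable_lebesgue_on:
  "f \<in> borel_measurable borel \<Longrightarrow> f \<in> borel_measurable (lebesgue_on S)"
  by (simp add: measurable_completion measurable_restrict_space1)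

lemma step_absolutely_integrable:
  fixes a :: "nat \<Rightarrow> 'a::euclidean_space"
  assumes T: "T > 0" "k \<ge> 1"
  shows "(\<lambda>t. a (cell_index T k t)) absolutely_integrable_on {0..T}"
proof (rule bounded_measurable_absolutely_integrable[where B="\<Sum>j<k. norm (a j)"])
  show "(\<lambda>t. a (cell_index T k t)) \<in> borel_measurable (lebesgue_on {0..T})"
    by (intro borel_measurable_lebesgue_on) measurable
  show "norm (a (cell_index T k t)) \<le> (\<Sum>j<k. norm (a j))" if "t \<in> {0..T}" for t
    using cell_index_less[OF T that] by (intro member_le_sum) auto
qed

lemma integral_cell_cong:
  fixes h :: "nat \<Rightarrow> real \<Rightarrow> 'a::real_normed_vector"
  assumes "T > 0" "k \<ge> 1"
  shows "integral {grid T k j..grid T k (Suc j)} (\<lambda>t. h (cell_index T k t) t) =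
    integral {grid T k j..grid T k (Suc j)} (h j)"
  \<comment> \<open>For \<open>j > 0\<close> the left node belongs to the previous cell, so the two
    integrands may differ there.\<close>
  by (rule integral_spike[of "{grid T k j}"]) (auto simp: cell_index_eq[OF assms, of j])

lemma integral_step:
  fixes a :: "nat \<Rightarrow> 'a::euclidean_space"
  assumes T: "T > 0" "k \<ge> 1"
  shows "integral {0..T} (\<lambda>t. a (cell_index T k t)) = (\<Sum>j<k. (T / real k) *\<^sub>R a j)"
proof -
  have "integral {0..T} (\<lambda>t. a (cell_index T k t)) =
     (\<Sum>j<k. integral {grid T k j..grid T k (Suc j)} (\<lambda>t. a (cell_index T k t)))"
    using integral_cells[OF T(1), of "\<lambda>t. a (cell_index T k t)" k k] T
      set_lebesgue_integral_eq_integral(1)[OF step_absolutely_integrable[OF T, of a]]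
    by simp
  also have "\<dots> = (\<Sum>j<k. (T / real k) *\<^sub>R a j)"
    using integral_cell_cong[OF T, of _ "\<lambda>j t. a j"] T by (simp add: grid_Suc)
  finally show ?thesis .
qed

text \<open>A measurable function is an almost everywhere limit of continuous functions. Projecting
  these onto a ball that contains the values of \<open>f\<close> keeps them continuous, does not
  disturb the limit, and gives the bound that dominated convergence asks for.\<close>

lemma continuous_approximation:
  fixes f :: "real \<Rightarrow> 'a::euclidean_space"
  assumes f: "f \<in> borel_measurable (lebesgue_on {a..b})" and B: "\<And>t. t \<in> {a..b} \<Longrightarrow> norm (f t) \<le> B"
    and e: "e > 0"
  obtains F where "continuous_on {a..b} F" "integral {a..b} (\<lambda>t. norm (f t - F t)) < e"
proof -
  have "f measurable_on {a..b}"
    using f by (simp add: measurable_on_iff_borel_measurable)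
  then obtain N g where N: "negligible N" and g: "\<And>n. continuous_on UNIV (g n)"
    and lim: "\<And>x. x \<notin> N \<Longrightarrow> (\<lambda>n. g n x) \<longlonglongrightarrow> (if x \<in> {a..b} then f x else 0)"
    unfolding measurable_on_def by blast
  \<comment> \<open>The absolute value keeps the ball nonempty when \<open>{a..b}\<close> is empty
    and \<open>B\<close> negative.\<close>
  define C where "C = \<bar>B\<bar>"
  have ball: "closed (cball (0::'a) C)" "cball (0::'a) C \<noteq> {}" "convex (cball (0::'a) C)"
    by (auto simp: C_def)
  define G where "G n t = closest_point (cball 0 C) (g n t)" for n t
  have contG: "continuous_on S (G n)" for n S
    unfolding G_def using continuous_on_compose2[OF continuous_on_closest_point[OF ball(3,1,2)] continuous_on_subset[OF g]]
    by blast
  have GC: "norm (G n t) \<le> C" for n t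
    using closest_point_in_set[OF ball(1,2), of "g n t"] by (simp add: G_def)
  have Glim: "(\<lambda>n. G n t) \<longlonglongrightarrow> f t" if "t \<in> {a..b} - N" for t
  proof -
    have "(\<lambda>n. g n t) \<longlonglongrightarrow> f t" using lim[of t] that by simp
    then have "(\<lambda>n. G n t) \<longlonglongrightarrow> closest_point (cball 0 C) (f t)"
      unfolding G_def by (rule isCont_tendsto_compose[OF continuous_at_closest_point[OF ball(3,1,2)]])
    moreover have "f t \<in> cball 0 C" using B[of t] that by (auto simp: C_def)
    ultimately show ?thesis by (simp add: closest_point_self)
  qed
  have fint: "f absolutely_integrable_on {a..b}"
    by (rule bounded_measurable_absolutely_integrable[OF f B])
  have Gint: "G n absolutely_integrable_on {a..b}" for n
    using absolutely_integrable_continuous_real[OF contG] .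
  let ?d = "\<lambda>n t. if t \<in> N then 0 else norm (f t - G n t)"
  have dint: "(\<lambda>t. norm (f t - G n t)) integrable_on {a..b}" for n
    using set_integral_diff(1)[OF fint Gint, of n] by (rule absolutely_integrable_on_def[THEN iffD1, THEN conjunct2])
  have "(\<lambda>n. integral {a..b} (?d n)) \<longlonglongrightarrow> integral {a..b} (\<lambda>_. 0::real)"
  proof (rule dominated_convergence(2))
    show "?d n integrable_on {a..b}" for n
      by (rule integrable_spike[OF dint[of n] N]) auto
    show "norm (?d n t) \<le> 2 * C" if "t \<in> {a..b}" for n t
      using B[OF that] GC[of n t] norm_triangle_ineq4[of "f t" "G n t"] by (auto simp: C_def)
    show "(\<lambda>n. ?d n t) \<longlonglongrightarrow> 0" if "t \<in> {a..b}" for t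
    proof (cases "t \<in> N")
      case False
      then have "(\<lambda>n. norm (f t - G n t)) \<longlonglongrightarrow> norm (f t - f t)"
        using Glim[of t] that by (intro tendsto_intros) auto
      with False show ?thesis by simp
    qed simp
  qed auto
  then have "\<forall>\<^sub>F n in sequentially. integral {a..b} (?d n) < e"
    using e by (intro order_tendstoD(2)) auto
  then obtain n where "integral {a..b} (?d n) < e"
    by (meson eventually_happens' sequentially_bot)
  moreover have "integral {a..b} (?d n) = integral {a..b} (\<lambda>t. norm (f t - G n t))"
    by (rule integral_spike[OF N]) auto
  ultimately show ?thesis using contG that by metis
qed

section \<open>Cell means as an averaging operator on L1\<close>

lemma norm_cell_mean_le:
  fixes f :: "real \<Rightarrow> 'a::euclidean_space"
  assumes T: "T > 0" "k \<ge> 1" and f: "f absolutely_integrable_on {0..T}" and j: "j < k"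
  shows "(T / real k) * norm (cell_mean T k f j) \<le> integral {grid T k j..grid T k (Suc j)} (\<lambda>t. norm (f t))"
proof -
  have fj: "f absolutely_integrable_on {grid T k j..grid T k (Suc j)}"
    by (rule absolutely_integrable_on_subinterval[OF f cell_subset[OF T(1) j]])
  have "(T / real k) * norm (cell_mean T k f j) = norm (integral {grid T k j..grid T k (Suc j)} f)"
    using T by (simp add: cell_mean_def)
  also have "\<dots> \<le> integral {grid T k j..grid T k (Suc j)} (\<lambda>t. norm (f t))"
    using fj by (intro integral_norm_bound_integral) (auto simp: absolutely_integrable_on_def)
  finally show ?thesis .
qed

text \<open>The mean of values in a closed ball stays in it. The exceptional set is allowed because
  memory terms are identified with integrals only off a null set.\<close>

lemma cell_mean_dist_le:
  fixes f :: "real \<Rightarrow> 'a::euclidean_space"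
  assumes T: "T > 0" "k \<ge> 1" and f: "f integrable_on {grid T k j..grid T k (Suc j)}"
    and N: "negligible N" and e: "e \<ge> 0"
    and le: "\<And>t. t \<in> {grid T k j..grid T k (Suc j)} - N \<Longrightarrow> norm (f t - c) \<le> e"
  shows "norm (cell_mean T k f j - c) \<le> e"
proof -
  let ?J = "{grid T k j..grid T k (Suc j)}"
  \<comment> \<open>Replacing the integrand by zero on \<open>N\<close> turns the bound off
    \<open>N\<close> into one that holds everywhere, by \<open>e \<ge> 0\<close>.\<close>
  let ?h = "\<lambda>t. if t \<in> N then 0 else f t - c"
  have int: "(\<lambda>t. f t - c) integrable_on ?J"
    using f by (intro integrable_diff) auto
  have "integral ?J (\<lambda>t. f t - c) = integral ?J f - (T / real k) *\<^sub>R c"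
    using T by (simp add: integral_diff[OF f integrable_const_ivl]) (simp add: grid_Suc)
  then have "cell_mean T k f j - c = (real k / T) *\<^sub>R integral ?J (\<lambda>t. f t - c)"
    using T by (simp add: cell_mean_def scaleR_diff_right)
  moreover have "integral ?J (\<lambda>t. f t - c) = integral ?J ?h"
    by (rule integral_spike[OF N]) auto
  moreover have "norm (integral ?J ?h) \<le> integral ?J (\<lambda>t. e)"
    using le e by (intro integral_norm_bound_integral integrable_spike[OF int N]) auto
  ultimately show ?thesis
    using T by (simp add: grid_Suc field_simps)
qed

text \<open>Averaging is an L1 contraction, so the difference from a continuous approximation
  \<open>F\<close> costs at most \<open>e / 3\<close> twice, once averaged and once not. Uniform
  continuity of \<open>F\<close> makes its own averaging error at most \<open>c\<close> pointwise,
  and \<open>c * T = e / 3\<close>.\<close>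

lemma cell_mean_L1_convergence:
  fixes f :: "real \<Rightarrow> 'a::euclidean_space"
  assumes T: "T > 0"
    and f: "f \<in> borel_measurable (lebesgue_on {0..T})" and B: "\<And>t. t \<in> {0..T} \<Longrightarrow> norm (f t) \<le> B"
  shows "(\<lambda>k. integral {0..T} (\<lambda>t. norm (cell_mean T k f (cell_index T k t) - f t))) \<longlonglongrightarrow> 0"
proof (rule LIMSEQ_I)
  fix e :: real assume e: "e > 0"
  obtain F where F: "continuous_on {0..T} F" "integral {0..T} (\<lambda>t. norm (f t - F t)) < e / 3"
    using continuous_approximation[OF f B, of "e/3"] e by auto
  have fint: "f absolutely_integrable_on {0..T}"
    by (rule bounded_measurable_absolutely_integrable[OF f B])
  have Fint: "F absolutely_integrable_on {0..T}"
    by (rule absolutely_integrable_continuous_real[OF F(1)])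
  have dint: "(\<lambda>t. f t - F t) absolutely_integrable_on {0..T}"
    by (rule set_integral_diff(1)[OF fint Fint])
  have nint: "(\<lambda>t. norm (f t - F t)) integrable_on {0..T}"
    using dint by (simp add: absolutely_integrable_on_def)
  define c where "c = e / (3 * T)"
  have c: "c > 0" using e T by (simp add: c_def)
  obtain d where d: "d > 0" "\<And>s t. s \<in> {0..T} \<Longrightarrow> t \<in> {0..T} \<Longrightarrow> dist s t < d \<Longrightarrow> dist (F s) (F t) < c"
    using compact_uniformly_continuous[OF F(1)] c unfolding uniformly_continuous_on_def
    by (metis compact_Icc)
  obtain K where K: "T / d < real K" using reals_Archimedean2 by blast
  show "\<exists>K. \<forall>k\<ge>K. norm (integral {0..T} (\<lambda>t. norm (cell_mean T k f (cell_index T k t) - f t)) - 0) < e"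
  proof (intro exI[of _ "Suc K"] allI impI)
    fix k assume k: "k \<ge> Suc K"
    then have k1: "k \<ge> 1" by simp
    have "T / d < real k" using K k by linarith
    then have h: "T / real k < d" using d(1) T k1 by (simp add: field_simps)
    note cells = cell_index_less[OF T k1]
    let ?D = "\<lambda>j. norm (cell_mean T k (\<lambda>t. f t - F t) j)"
    have pt: "norm (cell_mean T k f (cell_index T k t) - f t) \<le> ?D (cell_index T k t) + (c + norm (f t - F t))"
      if t: "t \<in> {0..T}" for t
    proof -
      let ?j = "cell_index T k t"
      note sub = cell_subset[OF T cells(1)[OF t]]
      have ints: "f integrable_on {grid T k ?j..grid T k (Suc ?j)}" "F integrable_on {grid T k ?j..grid T k (Suc ?j)}"
        using absolutely_integrable_on_subinterval[OF fint sub] absolutely_integrable_on_subinterval[OF Fint sub]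
        by (simp_all add: absolutely_integrable_on_def)
      have "norm (cell_mean T k F ?j - F t) \<le> c"
      proof (rule cell_mean_dist_le[OF T k1 ints(2) negligible_empty less_imp_le[OF c]])
        fix s assume "s \<in> {grid T k ?j..grid T k (Suc ?j)} - {}"
        then have s: "s \<in> {grid T k ?j..grid T k (Suc ?j)}" by simp
        then have "dist s t < d" using cells(2)[OF t] h by (auto simp: grid_Suc dist_norm)
        then show "norm (F s - F t) \<le> c"
          using d(2)[of s t] s sub t by (auto simp: dist_norm less_imp_le)
      qed
      moreover have "cell_mean T k f ?j = cell_mean T k (\<lambda>t. f t - F t) ?j + cell_mean T k F ?j"
        using ints by (simp add: cell_mean_def integral_diff scaleR_diff_right)
      ultimately show ?thesis
        using norm_triangle_ineq[of "cell_mean T k (\<lambda>t. f t - F t) ?j" "(cell_mean T k F ?j - F t) + (F t - f t)"]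
          norm_triangle_ineq[of "cell_mean T k F ?j - F t" "F t - f t"]
        by (simp add: norm_minus_commute algebra_simps)
    qed
    have int1: "(\<lambda>t. norm (cell_mean T k f (cell_index T k t) - f t)) integrable_on {0..T}"
      using set_integral_diff(1)[OF step_absolutely_integrable[OF T k1, of "cell_mean T k f"] fint]
      by (simp add: absolutely_integrable_on_def)
    have int2: "(\<lambda>t. ?D (cell_index T k t)) integrable_on {0..T}"
      using step_absolutely_integrable[OF T k1, of ?D] by (simp add: absolutely_integrable_on_def)
    have int3: "(\<lambda>t. c + norm (f t - F t)) integrable_on {0..T}"
      using nint by (intro integrable_add) auto
    have "integral {0..T} (\<lambda>t. norm (cell_mean T k f (cell_index T k t) - f t)) \<le>
       integral {0..T} (\<lambda>t. ?D (cell_index T k t) + (c + norm (f t - F t)))"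
      by (rule integral_le[OF int1 integrable_add[OF int2 int3] pt])
    also have "\<dots> = integral {0..T} (\<lambda>t. ?D (cell_index T k t)) + (c * T + integral {0..T} (\<lambda>t. norm (f t - F t)))"
      using T by (simp add: integral_add[OF int2 int3] integral_add[OF integrable_const_ivl nint])
    also have "integral {0..T} (\<lambda>t. ?D (cell_index T k t)) = (\<Sum>j<k. (T / real k) * ?D j)"
      using integral_step[OF T k1, of ?D] by simp
    also have "\<dots> \<le> (\<Sum>j<k. integral {grid T k j..grid T k (Suc j)} (\<lambda>t. norm (f t - F t)))"
      using norm_cell_mean_le[OF T k1 dint] by (intro sum_mono) auto
    also have "\<dots> = integral {0..T} (\<lambda>t. norm (f t - F t))"
      using integral_cells[OF T, of "\<lambda>t. norm (f t - F t)" k k] nint k1 by simp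
    finally have "integral {0..T} (\<lambda>t. norm (cell_mean T k f (cell_index T k t) - f t)) < e"
      using F(2) e T by (simp add: c_def)
    moreover have "integral {0..T} (\<lambda>t. norm (cell_mean T k f (cell_index T k t) - f t)) \<ge> 0"
      by (rule integral_nonneg[OF int1]) simp
    ultimately show "norm (integral {0..T} (\<lambda>t. norm (cell_mean T k f (cell_index T k t) - f t)) - 0) < e"
      by simp
  qed
qed

section \<open>Measurability of the memory term\<close>

text \<open>The representative is assembled from representatives of the coordinates; their finitely
  many exceptional sets form a null set.\<close>

lemma lebesgue_AE_borel:
  fixes f :: "'b::euclidean_space \<Rightarrow> 'a::euclidean_space"
  assumes f: "f \<in> borel_measurable lebesgue"
  obtains f' where "f' \<in> borel_measurable borel" "AE x in lborel. f x = f' x"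
proof -
  have "\<forall>b. \<exists>g \<in> borel_measurable lborel. AE x in lborel. f x \<bullet> b = g x"
    by (intro allI completion_ex_borel_measurable_real borel_measurable_inner f borel_measurable_const)
  then obtain h where h: "\<And>b. h b \<in> borel_measurable lborel" "\<And>b. AE x in lborel. f x \<bullet> b = h b x"
    by metis
  have "AE x in lborel. \<forall>b\<in>Basis. f x \<bullet> b = h b x"
    using h(2) by (intro AE_finite_allI) auto
  then have "AE x in lborel. f x = (\<Sum>b\<in>Basis. h b x *\<^sub>R b)"
    by eventually_elim (metis (no_types, lifting) euclidean_representation sum.cong)
  moreover have "(\<lambda>x. \<Sum>b\<in>Basis. h b x *\<^sub>R b) \<in> borel_measurable borel"
    using h(1) by (intro borel_measurable_sum borel_measurable_scaleR borel_measurable_const) simp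
  ultimately show thesis by (rule that[rotated])
qed

text \<open>Sections of a Lebesgue measurable function need not be measurable; almost all of them agree
  a.e. with those of a Borel representative, to which Fubini applies.\<close>
lemma lebesgue_sections:
  fixes f :: "real \<times> real \<Rightarrow> 'a::euclidean_space"
  assumes f: "f \<in> borel_measurable lebesgue"
  obtains N where "negligible N" "\<And>t. t \<notin> N \<Longrightarrow> (\<lambda>s. f (t, s)) \<in> borel_measurable lebesgue"
    "(\<lambda>t. \<integral>s. f (t, s) \<partial>lebesgue) \<in> borel_measurable lebesgue"
proof -
  obtain f' where f': "f' \<in> borel_measurable borel" "AE x in lborel. f x = f' x"
    using lebesgue_AE_borel[OF f] .
  have "AE x in lborel \<Otimes>\<^sub>M lborel. f x = f' x"
    by (subst lborel_prod) (rule f'(2))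
  from lborel_pair.AE_pair[OF this] have "AE t in lborel. AE s in lborel. f (t, s) = f' (t, s)" .
  then have "AE t in lebesgue. AE s in lborel. f (t, s) = f' (t, s)"
    by (rule AE_completion)
  then obtain N where N: "negligible N" and ae: "\<And>t. t \<notin> N \<Longrightarrow> AE s in lborel. f (t, s) = f' (t, s)"
    unfolding eventually_ae_filter_negligible by blast
  then have ae': "AE s in lebesgue. f' (t, s) = f (t, s)" if "t \<notin> N" for t
    using AE_completion[OF ae[OF that]] by (simp add: eq_commute)
  have sec': "(\<lambda>s. f' (t, s)) \<in> borel_measurable borel" for t
    using f'(1) by (rule measurable_compose[rotated]) simp
  have sec: "(\<lambda>s. f (t, s)) \<in> borel_measurable lebesgue" if "t \<notin> N" for t
    using sec' by (intro borel_measurable_AE[OF _ ae'[OF that]]) (simp add: measurable_completion)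
  have eq: "(\<integral>s. f' (t, s) \<partial>lborel) = (\<integral>s. f (t, s) \<partial>lebesgue)" if "t \<notin> N" for t
  proof -
    have "(\<integral>s. f (t, s) \<partial>lebesgue) = (\<integral>s. f' (t, s) \<partial>lebesgue)"
      using sec[OF that] sec'[of t] ae'[OF that]
      by (intro integral_cong_AE) (auto simp: measurable_completion eq_commute)
    also have "\<dots> = (\<integral>s. f' (t, s) \<partial>lborel)"
      using sec'[of t] by (simp add: integral_completion)
    finally show ?thesis by simp
  qed
  have "f' \<in> borel_measurable (lborel \<Otimes>\<^sub>M lborel)"
    using f'(1) by (simp add: lborel_prod)
  then have "(\<lambda>t. \<integral>s. f' (t, s) \<partial>lborel) \<in> borel_measurable lborel"
    using lborel.borel_measurable_lebesgue_integral[of "\<lambda>t s. f' (t, s)" lborel] by simp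
  then have "(\<lambda>t. \<integral>s. f' (t, s) \<partial>lborel) \<in> borel_measurable lebesgue"
    by (simp add: measurable_completion)
  \<comment> \<open>On \<open>N\<close> a section may fail to be measurable, and its integral is
    then the default 0. Completeness of the measure absorbs these times.\<close>
  moreover have "AE t in lebesgue. (\<integral>s. f' (t, s) \<partial>lborel) = (\<integral>s. f (t, s) \<partial>lebesgue)"
    unfolding eventually_ae_filter_negligible using N eq by blast
  ultimately have "(\<lambda>t. \<integral>s. f (t, s) \<partial>lebesgue) \<in> borel_measurable lebesgue"
    by (rule borel_measurable_AE)
  with N sec show thesis by (rule that)
qed

text \<open>A simple function takes finitely many values, so for the \<open>F i\<close>
  measurability of \<open>G\<close> at each fixed argument suffices; continuity in the argument
  passes to the limit.\<close>

lemma caratheodory_measurable: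
  fixes G :: "'c \<Rightarrow> 'a::euclidean_space \<Rightarrow> 'b::euclidean_space"
  assumes m: "\<And>x. (\<lambda>p. G p x) \<in> borel_measurable M"
    and c: "\<And>p. p \<in> space M \<Longrightarrow> continuous_on UNIV (G p)"
    and z: "z \<in> borel_measurable M"
  shows "(\<lambda>p. G p (z p)) \<in> borel_measurable M"
proof -
  obtain F where F: "\<And>i. simple_function M (F i)" "\<And>p. p \<in> space M \<Longrightarrow> (\<lambda>i. F i p) \<longlonglongrightarrow> z p"
    using borel_measurable_implies_sequence_metric[OF z, of 0] by blast
  show ?thesis
  proof (rule borel_measurable_LIMSEQ_metric)
    show "(\<lambda>p. G p (F i p)) \<in> borel_measurable M" for i
    proof (rule measurable_compose_countable'[where f="\<lambda>x p. G p x" and I="F i ` space M"])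
      show "F i \<in> M \<rightarrow>\<^sub>M count_space (F i ` space M)"
        using F(1)[of i] by (subst measurable_count_space_eq2) (auto simp: simple_function_def)
      show "countable (F i ` space M)"
        using F(1)[of i] by (simp add: simple_function_def countable_finite)
    qed (rule m)
    show "(\<lambda>i. G p (F i p)) \<longlonglongrightarrow> G p (z p)" if "p \<in> space M" for p
      using F(2)[OF that] c[OF that] by (auto intro: continuous_on_tendsto_compose)
  qed
qed

text \<open>Borel measurability of \<open>z\<close> survives composition with the projection
  \<open>snd\<close>, so \<open>z\<close> can be inserted into \<open>g\<close> as a function on the
  square; then \<open>lebesgue_sections\<close> applies.\<close>

lemma memory_term_measurable:
  fixes g :: "real \<Rightarrow> real \<Rightarrow> real ^ 'n \<Rightarrow> real ^ 'n"
  assumes gm: "\<And>x. (\<lambda>(t, s). g t s x) \<in> borel_measurable (lebesgue_on ({0..T} \<times> {0..T}))"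
    and gc: "\<And>t s. t \<in> {0..T} \<Longrightarrow> s \<in> {0..T} \<Longrightarrow> continuous_on UNIV (g t s)"
    and z: "z \<in> borel_measurable borel"
  obtains N where "negligible N"
    "\<And>t. t \<in> {0..T} - N \<Longrightarrow> (\<lambda>s. g t s (z s)) \<in> borel_measurable (lebesgue_on {0..t})"
    "memory_term g z \<in> borel_measurable (lebesgue_on {0..T})"
proof -
  \<comment> \<open>Extending the integrand by zero off this triangle makes the integral over
    \<open>{0..t}\<close> the integral of a full section.\<close>
  let ?Q = "{p. 0 \<le> snd p \<and> snd p \<le> fst p \<and> fst p \<le> T} :: (real \<times> real) set"
  define f where "f p = (if p \<in> ?Q then g (fst p) (snd p) (z (snd p)) else 0)" for p
  have "closed ?Q"
    by (intro closed_Collect_conj closed_Collect_le continuous_intros)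
  then have Qs: "?Q \<in> sets lebesgue"
    by (intro sets_completionI_sets) (simp only: sets_lborel borel_closed)
  have sq: "{0..T} \<times> {0..T} \<in> sets lebesgue"
    using lmeasurable_compact compact_Times[of "{0..T}" "{0..T}"] by (metis compact_Icc fmeasurableD)
  have "(\<lambda>p. g (fst p) (snd p) (z (snd p))) \<in> borel_measurable (lebesgue_on ({0..T} \<times> {0..T}))"
  proof (rule caratheodory_measurable[where G="\<lambda>p. g (fst p) (snd p)"])
    show "(\<lambda>p. g (fst p) (snd p) x) \<in> borel_measurable (lebesgue_on ({0..T} \<times> {0..T}))" for x
      using gm[of x] unfolding split_beta' .
    show "continuous_on UNIV (g (fst p) (snd p))" if "p \<in> space (lebesgue_on ({0..T} \<times> {0..T}))" for p
      using that by (intro gc) auto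
    have "(\<lambda>p::real \<times> real. z (snd p)) \<in> borel_measurable borel"
      by (intro measurable_compose[OF _ z] borel_measurable_continuous_onI continuous_intros)
    then show "(\<lambda>p. z (snd p)) \<in> borel_measurable (lebesgue_on ({0..T} \<times> {0..T}))"
      by (simp add: measurable_completion measurable_restrict_space1)
  qed
  then have sqm: "(\<lambda>p. if p \<in> {0..T} \<times> {0..T} then g (fst p) (snd p) (z (snd p)) else 0) \<in> borel_measurable lebesgue"
    using sq by (simp add: borel_measurable_if)
  have "(\<lambda>p. if p \<in> ?Q then (if p \<in> {0..T} \<times> {0..T} then g (fst p) (snd p) (z (snd p)) else 0) else 0)
      \<in> borel_measurable lebesgue"
    by (rule measurable_If_set[OF sqm borel_measurable_const])
       (simp only: space_completion space_lborel space_borel Int_UNIV_right Qs)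
  also have "(\<lambda>p. if p \<in> ?Q then (if p \<in> {0..T} \<times> {0..T} then g (fst p) (snd p) (z (snd p)) else 0) else 0) = f"
    by (force simp: f_def fun_eq_iff)
  finally have f: "f \<in> borel_measurable lebesgue" .
  obtain N where N: "negligible N" "\<And>t. t \<notin> N \<Longrightarrow> (\<lambda>s. f (t, s)) \<in> borel_measurable lebesgue"
    "(\<lambda>t. \<integral>s. f (t, s) \<partial>lebesgue) \<in> borel_measurable lebesgue"
    using lebesgue_sections[OF f] by blast
  show thesis
  proof (rule that[OF N(1)])
    fix t assume t: "t \<in> {0..T} - N"
    have "(\<lambda>s. if s \<in> {0..t} then g t s (z s) else 0) = (\<lambda>s. f (t, s))"
      using t by (auto simp: f_def fun_eq_iff)
    with N(2)[of t] t show "(\<lambda>s. g t s (z s)) \<in> borel_measurable (lebesgue_on {0..t})"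
      by (intro borel_measurable_if_D) auto
  next
    have "memory_term g z t = (\<integral>s. f (t, s) \<partial>lebesgue)" if "t \<in> {0..T}" for t
      unfolding memory_term_def set_lebesgue_integral_def
      using that by (intro Bochner_Integration.integral_cong) (auto simp: f_def indicator_def)
    then show "memory_term g z \<in> borel_measurable (lebesgue_on {0..T})"
      using measurable_restrict_space1[OF N(3), of "{0..T}"]
      by (subst measurable_cong[of _ _ "\<lambda>t. \<integral>s. f (t, s) \<partial>lebesgue"]) auto
  qed
qed

text \<open>The bound holds at every \<open>t\<close>, including those where the integrand is not
  integrable: there the Bochner integral is 0 by convention.\<close>

lemma norm_memory_term_le:
  fixes g :: "real \<Rightarrow> real \<Rightarrow> real ^ 'n \<Rightarrow> real ^ 'n"
  assumes le: "\<And>s. s \<in> {0..t} \<Longrightarrow> norm (g t s (z s)) \<le> C" and t: "0 \<le> t" and C: "0 \<le> C"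
  shows "norm (memory_term g z t) \<le> C * t"
proof (cases "set_integrable lebesgue {0..t} (\<lambda>s. g t s (z s))")
  case True
  have "norm (memory_term g z t) = norm (integral {0..t} (\<lambda>s. g t s (z s)))"
    using set_lebesgue_integral_eq_integral(2)[OF True] by (simp add: memory_term_def)
  also have "\<dots> \<le> integral {0..t} (\<lambda>s. C)"
    using le set_lebesgue_integral_eq_integral(1)[OF True] by (intro integral_norm_bound_integral) auto
  finally show ?thesis using t by (simp add: mult.commute)
next
  case False
  then have "memory_term g z t = 0"
    unfolding memory_term_def set_lebesgue_integral_def set_integrable_def
    by (simp add: not_integrable_integral_eq)
  then show ?thesis using t C by simp
qed

section \<open>The discrete scheme and its a priori bound\<close>

text \<open>The recursion has memory, so one step is controlled by a common bound \<open>E\<close>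
  of all earlier errors. In the applications \<open>a\<close> is \<open>T / real k\<close> times a
  constant, which makes the exponential factor independent of \<open>k\<close>.\<close>

lemma discrete_gronwall:
  fixes e c :: "nat \<Rightarrow> real"
  assumes a: "a \<ge> 0" and b: "b \<ge> 0" "e 0 \<le> b" and c: "\<And>j. j < k \<Longrightarrow> c j \<ge> 0"
    and step: "\<And>j E. j < k \<Longrightarrow> (\<And>i. i \<le> j \<Longrightarrow> e i \<le> E) \<Longrightarrow> 0 \<le> E \<Longrightarrow> e (Suc j) \<le> (1 + a) * E + c j"
    and j: "j \<le> k"
  shows "e j \<le> exp (a * real k) * (b + (\<Sum>i<k. c i))"
proof -
  \<comment> \<open>This majorant solves the linear recursion with an excess and is nondecreasing,
    so one value bounds the whole past; the induction carries that statement.\<close>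
  define E where "E j = (1 + a) ^ j * (b + (\<Sum>i<j. c i))" for j
  have sum0: "0 \<le> (\<Sum>i<j. c i)" if "j \<le> k" for j
    using that c by (intro sum_nonneg) auto
  have E0: "0 \<le> E j" if "j \<le> k" for j
    using sum0[OF that] a b by (simp add: E_def)
  have grow: "(1 + a) * E j + c j \<le> E (Suc j)" if "j < k" for j
  proof -
    have "c j \<le> (1 + a) ^ Suc j * c j"
      using c[OF that] one_le_power[of "1 + a" "Suc j"] a by (simp add: mult_le_cancel_right1)
    then show ?thesis by (simp add: E_def algebra_simps)
  qed
  have le: "\<forall>i\<le>j. e i \<le> E j" if "j \<le> k" for j
    using that
  proof (induction j)
    case 0 then show ?case using b by (simp add: E_def)
  next
    case (Suc j)
    then have IH: "\<And>i. i \<le> j \<Longrightarrow> e i \<le> E j" and jk: "j < k" by auto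
    have "E j \<le> (1 + a) * E j + c j"
      using a c[OF jk] E0[of j] jk by (simp add: algebra_simps)
    with grow[OF jk] have mono: "E j \<le> E (Suc j)" by linarith
    have "e (Suc j) \<le> E (Suc j)"
      using step[OF jk IH E0] grow[OF jk] jk by force
    then show ?case using IH mono by (metis le_SucE order_trans)
  qed
  have "(1 + a) ^ j \<le> exp a ^ k"
  proof -
    have "(1 + a) ^ j \<le> (1 + a) ^ k" using a j by (intro power_increasing) auto
    also have "\<dots> \<le> exp a ^ k" using a by (intro power_mono exp_ge_add_one_self) auto
    finally show ?thesis .
  qed
  then have p: "(1 + a) ^ j \<le> exp (a * real k)" by (simp add: exp_of_nat2_mult)
  have "(\<Sum>i<j. c i) \<le> (\<Sum>i<k. c i)"
    using j c by (intro sum_mono2) auto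
  then have "E j \<le> exp (a * real k) * (b + (\<Sum>i<k. c i))"
    unfolding E_def using p b sum0[OF j] by (intro mult_mono) auto
  with le[OF j] show ?thesis by force
qed

text \<open>Recursion in which the next value depends on all earlier ones. The hypothesis says that
  \<open>\<Phi> j\<close> cannot see entries beyond \<open>j\<close>, so filler values there do no
  harm.\<close>

lemma history_recursion:
  fixes \<Phi> :: "nat \<Rightarrow> (nat \<Rightarrow> 'a) \<Rightarrow> 'a"
  assumes dep: "\<And>j \<xi> \<eta>. (\<And>i. i \<le> j \<Longrightarrow> \<xi> i = \<eta> i) \<Longrightarrow> \<Phi> j \<xi> = \<Phi> j \<eta>"
  obtains \<xi> where "\<xi> 0 = a" "\<And>j. \<xi> (Suc j) = \<Phi> j \<xi>"
proof -
  \<comment> \<open>\<open>H j\<close> is a history that is final up to entry \<open>j\<close> and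
    carries the filler \<open>a\<close> beyond; the solution is the diagonal.\<close>
  define H where "H = rec_nat (\<lambda>_. a) (\<lambda>j h. h(Suc j := \<Phi> j h))"
  have H0: "H 0 = (\<lambda>_. a)" and HS: "H (Suc j) = (H j)(Suc j := \<Phi> j (H j))" for j
    by (simp_all add: H_def)
  have stable: "H n i = H i i" if "i \<le> n" for i n
    using that by (induction n) (auto simp: HS le_Suc_eq)
  show thesis
  proof (rule that[of "\<lambda>j. H j j"])
    show "H (Suc j) (Suc j) = \<Phi> j (\<lambda>i. H i i)" for j
    proof -
      have "\<Phi> j (H j) = \<Phi> j (\<lambda>i. H i i)" by (rule dep) (rule stable)
      then show ?thesis by (simp add: HS)
    qed
  qed (simp add: H0)
qed

text \<open>A function of the whole node sequence that reads only the entries up to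
  \<open>j\<close>, as \<open>history_recursion\<close> requires.\<close>

definition discrete_memory ::
    "real \<Rightarrow> nat \<Rightarrow> (real \<Rightarrow> real \<Rightarrow> real ^ 'n \<Rightarrow> real ^ 'n) \<Rightarrow> (nat \<Rightarrow> real ^ 'n) \<Rightarrow> nat \<Rightarrow> real ^ 'n" where
  "discrete_memory T k g \<xi> j = (1 / (grid T k (Suc j) - grid T k j)) *\<^sub>R
     (LINT t:{grid T k j..grid T k (Suc j)}|lebesgue.
        (\<Sum>i<j. LINT s:{grid T k i..grid T k (Suc i)}|lebesgue. g t s (\<xi> i)) +
        (LINT s:{grid T k j..t}|lebesgue. g t s (\<xi> j)))"

text \<open>The assumptions in the form in which the estimates use them, with the constants fixed:
  (F2) supplies a nearby point, and the Jacobian bound has become a Lipschitz estimate on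
  balls.\<close>

locale scheme_data =
  fixes T m l \<beta> :: real
    and F :: "real \<Rightarrow> real ^ 'n \<Rightarrow> (real ^ 'n) set"
    and g :: "real \<Rightarrow> real \<Rightarrow> real ^ 'n \<Rightarrow> real ^ 'n"
    and x0 :: "real ^ 'n"
  assumes T_pos: "T > 0" and m_nonneg: "m \<ge> 0" and l_nonneg: "l \<ge> 0" and beta_nonneg: "\<beta> \<ge> 0"
    and F_nonempty: "t \<in> {0..T} \<Longrightarrow> F t x \<noteq> {}"
    and F_closed: "t \<in> {0..T} \<Longrightarrow> closed (F t x)"
    and F_bound: "t \<in> {0..T} \<Longrightarrow> y \<in> F t x \<Longrightarrow> norm y \<le> m"
    and F_lipschitz: "t \<in> {0..T} \<Longrightarrow> y \<in> F t x1 \<Longrightarrow> \<exists>y'\<in>F t x2. norm (y - y') \<le> l * norm (x1 - x2)"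
    and g_measurable: "(\<lambda>(t, s). g t s x) \<in> borel_measurable (lebesgue_on ({0..T} \<times> {0..T}))"
    and g_growth: "t \<in> {0..T} \<Longrightarrow> s \<in> {0..t} \<Longrightarrow> norm (g t s x) \<le> \<beta> * (1 + norm x)"
    and g_continuous: "t \<in> {0..T} \<Longrightarrow> s \<in> {0..T} \<Longrightarrow> continuous_on UNIV (g t s)"
    and g_lipschitz: "\<And>\<eta>. \<eta> > 0 \<Longrightarrow> \<exists>\<alpha>\<ge>0. \<forall>t\<in>{0..T}. \<forall>s\<in>{0..t}. \<forall>x\<in>cball 0 \<eta>. \<forall>y\<in>cball 0 \<eta>.
          norm (g t s x - g t s y) \<le> \<alpha> * norm (x - y)"
begin

lemma grid_in: "j < k \<Longrightarrow> grid T k j \<in> {0..T}"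
  using grid_nonneg[OF T_pos] grid_le[OF T_pos, of k j] by simp

text \<open>Causality: up to the end of cell \<open>j\<close> the step function shows only node
  values with index at most \<open>j\<close>.\<close>

lemma cell_index_le:
  assumes k: "k \<ge> 1" and s: "s \<in> {0..T}" "s \<le> grid T k (Suc j)"
  shows "cell_index T k s \<le> j"
proof (rule ccontr)
  assume less: "\<not> cell_index T k s \<le> j"
  then have "s \<noteq> 0" by (metis cell_index_0 le0)
  then have "grid T k (cell_index T k s) < s"
    using cell_index_bounds(2)[OF T_pos k, of s] s by auto
  moreover have "grid T k (Suc j) \<le> grid T k (cell_index T k s)"
    using less by (intro grid_mono[OF T_pos]) auto
  ultimately show False using s by auto
qed

lemma norm_memory_term_le_growth:
  assumes t: "t \<in> {0..T}" and z: "\<And>s. s \<in> {0..t} \<Longrightarrow> norm (z s) \<le> R"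
  shows "norm (memory_term g z t) \<le> \<beta> * (1 + R) * T"
proof -
  have R: "0 \<le> R" using z[of 0] t norm_ge_zero[of "z 0"] by (simp del: norm_ge_zero)
  have "norm (memory_term g z t) \<le> \<beta> * (1 + R) * t"
  proof (rule norm_memory_term_le)
    fix s assume s: "s \<in> {0..t}"
    have "norm (g t s (z s)) \<le> \<beta> * (1 + norm (z s))" by (rule g_growth[OF t s])
    also have "\<dots> \<le> \<beta> * (1 + R)" using z[OF s] beta_nonneg by (intro mult_left_mono) auto
    finally show "norm (g t s (z s)) \<le> \<beta> * (1 + R)" .
  qed (use t R beta_nonneg in auto)
  also have "\<dots> \<le> \<beta> * (1 + R) * T"
    using t R beta_nonneg by (intro mult_left_mono) auto
  finally show ?thesis .
qed

text \<open>The third claim makes the memory term a Henstock-Kurzweil integral, which can be split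
  over cells; sections of \<open>g\<close> may be nonmeasurable on a null set of times, whence the
  exceptional set.\<close>

lemma memory_term_integrable:
  assumes z: "z \<in> borel_measurable borel" and R: "\<And>s. s \<in> {0..T} \<Longrightarrow> norm (z s) \<le> R"
  shows "memory_term g z \<in> borel_measurable (lebesgue_on {0..T})"
    and "memory_term g z absolutely_integrable_on {0..T}"
    and "\<exists>N. negligible N \<and> (\<forall>t\<in>{0..T} - N. (\<lambda>s. g t s (z s)) absolutely_integrable_on {0..t} \<and>
           memory_term g z t = integral {0..t} (\<lambda>s. g t s (z s)))"
proof -
  obtain N where N: "negligible N"
    "\<And>t. t \<in> {0..T} - N \<Longrightarrow> (\<lambda>s. g t s (z s)) \<in> borel_measurable (lebesgue_on {0..t})"
    and m: "memory_term g z \<in> borel_measurable (lebesgue_on {0..T})"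
    using memory_term_measurable[OF g_measurable g_continuous z] by blast
  show "memory_term g z \<in> borel_measurable (lebesgue_on {0..T})" by (rule m)
  show "memory_term g z absolutely_integrable_on {0..T}"
    using R by (intro bounded_measurable_absolutely_integrable[OF m norm_memory_term_le_growth[where R=R]]) auto
  have *: "(\<lambda>s. g t s (z s)) absolutely_integrable_on {0..t}" if t: "t \<in> {0..T} - N" for t
  proof (rule bounded_measurable_absolutely_integrable[OF N(2)[OF t]])
    fix s assume s: "s \<in> {0..t}"
    have "norm (g t s (z s)) \<le> \<beta> * (1 + norm (z s))" using t s by (intro g_growth) auto
    also have "\<dots> \<le> \<beta> * (1 + R)" using R[of s] t s beta_nonneg by (intro mult_left_mono) auto
    finally show "norm (g t s (z s)) \<le> \<beta> * (1 + R)" .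
  qed
  moreover have "memory_term g z t = integral {0..t} (\<lambda>s. g t s (z s))" if "t \<in> {0..T} - N" for t
    using set_lebesgue_integral_eq_integral(2)[OF *[OF that]] by (simp add: memory_term_def)
  ultimately show "\<exists>N. negligible N \<and> (\<forall>t\<in>{0..T} - N. (\<lambda>s. g t s (z s)) absolutely_integrable_on {0..t} \<and>
           memory_term g z t = integral {0..t} (\<lambda>s. g t s (z s)))"
    using N(1) by blast
qed

abbreviation step_fun :: "nat \<Rightarrow> (nat \<Rightarrow> real ^ 'n) \<Rightarrow> real \<Rightarrow> real ^ 'n" where
  "step_fun k \<xi> \<equiv> \<lambda>s. \<xi> (cell_index T k s)"

text \<open>A crude bound, depending on \<open>k\<close>, that only serves to make memory terms of
  step functions integrable. The uniform bound is \<open>scheme_bounded\<close>.\<close>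

lemma norm_step_fun_le:
  assumes "k \<ge> 1" "s \<in> {0..T}"
  shows "norm (step_fun k \<xi> s) \<le> (\<Sum>i<k. norm (\<xi> i))"
  using cell_index_less[OF T_pos assms] by (intro member_le_sum) auto

text \<open>For \<open>t\<close> in cell \<open>j\<close> the sum over completed cells plus the
  integral over the current one is the memory term of the step function at \<open>t\<close>. Thus
  the scheme's vector is an ordinary cell mean, directly comparable with the mean of the memory term
  of the solution.\<close>

lemma discrete_memory_eq_cell_mean:
  assumes k: "k \<ge> 1" and j: "j < k"
  shows "discrete_memory T k g \<xi> j = cell_mean T k (memory_term g (step_fun k \<xi>)) j"
proof -
  let ?z = "step_fun k \<xi>" and ?J = "\<lambda>i. {grid T k i..grid T k (Suc i)}"
  let ?M = "memory_term g ?z"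
  let ?H = "\<lambda>t. (\<Sum>i<j. LINT s:?J i|lebesgue. g t s (\<xi> i)) + (LINT s:{grid T k j..t}|lebesgue. g t s (\<xi> j))"
  have z: "?z \<in> borel_measurable borel" by measurable
  note mi = memory_term_integrable[OF z norm_step_fun_le[OF k]]
  obtain N where N: "negligible N"
    and sec: "\<And>t. t \<in> {0..T} - N \<Longrightarrow> (\<lambda>s. g t s (?z s)) absolutely_integrable_on {0..t}"
    and M: "\<And>t. t \<in> {0..T} - N \<Longrightarrow> ?M t = integral {0..t} (\<lambda>s. g t s (?z s))"
    using mi(3) by blast
  have sub: "?J j \<subseteq> {0..T}" by (rule cell_subset[OF T_pos j])
  have HM: "?H t = ?M t" if t: "t \<in> ?J j - (N \<union> {grid T k j})" for t
  proof -
    have tT: "t \<in> {0..T} - N" using t sub by auto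
    let ?h = "\<lambda>s. g t s (?z s)"
    have abs: "?h absolutely_integrable_on {0..t}" by (rule sec[OF tT])
    then have int: "?h integrable_on {0..t}" by (rule set_lebesgue_integral_eq_integral(1))
    \<comment> \<open>The upper end \<open>b\<close> is free, so this covers the completed cells and
      also the current cell cut off at \<open>t\<close>.\<close>
    have piece: "(LINT s:{a..b}|lebesgue. g t s (\<xi> i)) = integral {a..b} ?h"
      if ab: "{a..b} \<subseteq> {0..t}" "a = grid T k i" "b \<le> grid T k (Suc i)" for a b i
    proof -
      have eq: "g t s (\<xi> i) = ?h s" if "s \<in> {a..b} - {a}" for s
        using cell_index_eq[OF T_pos k, of i s] that ab by auto
      have "(\<lambda>s. g t s (\<xi> i)) absolutely_integrable_on {a..b}"
        by (rule absolutely_integrable_spike[OF absolutely_integrable_on_subinterval[OF abs ab(1)] negligible_sing eq])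
      then have "(LINT s:{a..b}|lebesgue. g t s (\<xi> i)) = integral {a..b} (\<lambda>s. g t s (\<xi> i))"
        by (rule set_lebesgue_integral_eq_integral(2))
      also have "\<dots> = integral {a..b} ?h"
        by (rule integral_spike[OF negligible_sing eq[symmetric]])
      finally show ?thesis .
    qed
    have gj: "0 \<le> grid T k j" "grid T k j \<le> t" "t \<le> grid T k (Suc j)"
      using t grid_nonneg[OF T_pos] by auto
    have "?J i \<subseteq> {0..t}" if "i < j" for i
      using gj(2) grid_nonneg[OF T_pos, of k i] grid_mono[OF T_pos, of "Suc i" j k] that by auto
    then have "(\<Sum>i<j. LINT s:?J i|lebesgue. g t s (\<xi> i)) = (\<Sum>i<j. integral (?J i) ?h)"
      using piece by (intro sum.cong) auto
    also have "\<dots> = integral {0..grid T k j} ?h"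
      using gj by (intro integral_cells[symmetric] T_pos integrable_subinterval_real[OF int]) auto
    finally have "?H t = integral {0..grid T k j} ?h + integral {grid T k j..t} ?h"
      using gj piece[of "grid T k j" t j] by simp
    also have "\<dots> = integral {0..t} ?h"
      using gj by (intro Henstock_Kurzweil_Integration.integral_combine int) auto
    finally show ?thesis using M[OF tT] by simp
  qed
  have neg: "negligible (N \<union> {grid T k j})" using N by simp
  have "?H absolutely_integrable_on ?J j"
    by (rule absolutely_integrable_spike[OF absolutely_integrable_on_subinterval[OF mi(2) sub] neg HM])
  then have "(LINT t:?J j|lebesgue. ?H t) = integral (?J j) ?H"
    by (rule set_lebesgue_integral_eq_integral(2))
  also have "\<dots> = integral (?J j) ?M"
    by (rule integral_spike[OF neg HM[symmetric]])
  finally show ?thesis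
    unfolding discrete_memory_def cell_mean_def by (simp add: grid_Suc)
qed

definition is_scheme :: "nat \<Rightarrow> (nat \<Rightarrow> real ^ 'n) \<Rightarrow> (nat \<Rightarrow> real ^ 'n) \<Rightarrow> (nat \<Rightarrow> real ^ 'n) \<Rightarrow> bool" where
  "is_scheme k \<xi> u w \<longleftrightarrow> \<xi> 0 = x0 \<and>
     (\<forall>j<k. \<xi> (Suc j) = \<xi> j + (T / real k) *\<^sub>R (u j + w j) \<and> u j \<in> F (grid T k j) (\<xi> j) \<and>
        w j = discrete_memory T k g \<xi> j)"

text \<open>A nearest point to \<open>p j\<close> exists in a closed nonempty set, convex or not,
  and \<open>closest_point\<close> picks one. \<open>history_recursion\<close> enters because the
  memory reads all earlier nodes. Later \<open>p\<close> is the sequence of cell means of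
  \<open>ubar\<close>.\<close>

lemma scheme_exists:
  fixes p :: "nat \<Rightarrow> real ^ 'n"
  obtains \<xi> u w where "is_scheme k \<xi> u w"
    "\<And>j y. j < k \<Longrightarrow> y \<in> F (grid T k j) (\<xi> j) \<Longrightarrow> norm (u j - p j) \<le> norm (y - p j)"
proof -
  define U where "U j \<xi> = closest_point (F (grid T k j) (\<xi> j)) (p j)" for j and \<xi> :: "nat \<Rightarrow> real ^ 'n"
  obtain \<xi> where \<xi>: "\<xi> 0 = x0"
    "\<And>j. \<xi> (Suc j) = \<xi> j + (T / real k) *\<^sub>R (U j \<xi> + discrete_memory T k g \<xi> j)"
    by (rule history_recursion[of "\<lambda>j \<xi>. \<xi> j + (T / real k) *\<^sub>R (U j \<xi> + discrete_memory T k g \<xi> j)" x0])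
       (simp_all add: U_def discrete_memory_def)
  show thesis
  proof (rule that[of \<xi> "\<lambda>j. U j \<xi>" "discrete_memory T k g \<xi>"])
    have "U j \<xi> \<in> F (grid T k j) (\<xi> j)" if "j < k" for j
      unfolding U_def using grid_in[OF that] F_closed F_nonempty by (intro closest_point_in_set) auto
    then show "is_scheme k \<xi> (\<lambda>j. U j \<xi>) (discrete_memory T k g \<xi>)"
      using \<xi> by (simp add: is_scheme_def)
    show "norm (U j \<xi> - p j) \<le> norm (y - p j)" if "j < k" "y \<in> F (grid T k j) (\<xi> j)" for j y
      using closest_point_le[OF F_closed[OF grid_in[OF that(1)]] that(2), of "p j"]
      by (simp add: U_def dist_norm norm_minus_commute)
  qed
qed

lemma scheme_w_bound:
  assumes k: "k \<ge> 1" and sch: "is_scheme k \<xi> u w" and j: "j < k"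
    and E: "\<And>i. i \<le> j \<Longrightarrow> norm (\<xi> i) \<le> E"
  shows "norm (w j) \<le> \<beta> * (1 + E) * T"
proof -
  let ?M = "memory_term g (step_fun k \<xi>)" and ?J = "{grid T k j..grid T k (Suc j)}"
  have E0: "0 \<le> E" using E[of 0] norm_ge_zero[of "\<xi> 0"] by (simp del: norm_ge_zero)
  have "step_fun k \<xi> \<in> borel_measurable borel" by measurable
  note mi = memory_term_integrable[OF this norm_step_fun_le[OF k]]
  have sub: "?J \<subseteq> {0..T}" by (rule cell_subset[OF T_pos j])
  have "norm (cell_mean T k ?M j - 0) \<le> \<beta> * (1 + E) * T"
  proof (rule cell_mean_dist_le[OF T_pos k _ negligible_empty])
    show "?M integrable_on ?J"
      using absolutely_integrable_on_subinterval[OF mi(2) sub] by (rule set_lebesgue_integral_eq_integral(1))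
    show "0 \<le> \<beta> * (1 + E) * T" using beta_nonneg E0 T_pos by simp
    fix t assume "t \<in> ?J - {}"
    then have t: "t \<in> {0..T}" "t \<le> grid T k (Suc j)" using sub by auto
    have "norm (?M t) \<le> \<beta> * (1 + E) * T"
    proof (rule norm_memory_term_le_growth[OF t(1)])
      fix s assume s: "s \<in> {0..t}"
      have "cell_index T k s \<le> j"
        using s t by (intro cell_index_le[OF k]) auto
      then show "norm (step_fun k \<xi> s) \<le> E" by (rule E)
    qed
    then show "norm (?M t - 0) \<le> \<beta> * (1 + E) * T" by simp
  qed
  then show ?thesis
    using sch j discrete_memory_eq_cell_mean[OF k j] by (simp add: is_scheme_def)
qed

text \<open>Gronwall constant for \<open>1 + norm\<close>, the quantity in which the growth
  condition on \<open>g\<close> is homogeneous: one step multiplies its bound by at most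
  \<open>1 + (T / real k) * (m + \<beta> * T)\<close>.\<close>

definition scheme_bound :: real where
  "scheme_bound = (1 + norm x0) * exp ((m + \<beta> * T) * T)"

lemma scheme_bounded:
  assumes k: "k \<ge> 1" and sch: "is_scheme k \<xi> u w" and j: "j \<le> k"
  shows "1 + norm (\<xi> j) \<le> scheme_bound"
proof -
  let ?h = "T / real k"
  have h: "?h \<ge> 0" using T_pos by simp
  have "1 + norm (\<xi> j) \<le> exp (?h * (m + \<beta> * T) * real k) * ((1 + norm x0) + (\<Sum>i<k. 0))"
  proof (rule discrete_gronwall[OF _ _ _ _ _ j])
    fix j E assume jk: "j < k" and E: "\<And>i. i \<le> j \<Longrightarrow> 1 + norm (\<xi> i) \<le> E"
    have E1: "1 \<le> E" using E[of 0] by (smt (verit) norm_ge_zero le0)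
    have "norm (w j) \<le> \<beta> * (1 + (E - 1)) * T"
      using E by (intro scheme_w_bound[OF k sch jk]) force
    moreover have "norm (u j) \<le> m"
      using sch jk by (intro F_bound[OF grid_in]) (auto simp: is_scheme_def)
    \<comment> \<open>Since \<open>E \<ge> 1\<close>, the bound of \<open>F\<close> is absorbed into
      the growth rate and no source term remains.\<close>
    moreover have "m \<le> m * E" using E1 m_nonneg by (simp add: mult_le_cancel_left1)
    ultimately have "norm (u j + w j) \<le> (m + \<beta> * T) * E"
      using norm_triangle_ineq[of "u j" "w j"] by (simp add: algebra_simps)
    then have "?h * norm (u j + w j) \<le> ?h * ((m + \<beta> * T) * E)"
      using h by (rule mult_left_mono)
    moreover have "\<xi> (Suc j) = \<xi> j + ?h *\<^sub>R (u j + w j)"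
      using sch jk unfolding is_scheme_def by blast
    then have "norm (\<xi> (Suc j)) \<le> norm (\<xi> j) + ?h * norm (u j + w j)"
      using norm_triangle_ineq[of "\<xi> j" "?h *\<^sub>R (u j + w j)"] T_pos by simp
    ultimately show "1 + norm (\<xi> (Suc j)) \<le> (1 + ?h * (m + \<beta> * T)) * E + 0"
      using E[of j] by (simp add: algebra_simps)
  qed (use sch h m_nonneg beta_nonneg T_pos in \<open>auto simp: is_scheme_def\<close>)
  also have "exp (?h * (m + \<beta> * T) * real k) = exp ((m + \<beta> * T) * T)"
    using k by simp
  finally show ?thesis by (simp add: scheme_bound_def mult.commute)
qed

end

section \<open>Distance between the scheme and the solution\<close>

text \<open>Outside \<open>{0..T}\<close> nothing is known about \<open>x\<close>. Its extension by
  zero is Borel on the whole line and has the same memory term on \<open>{0..T}\<close>.\<close>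

lemma (in scheme_data) memory_term_regular:
  assumes x_continuous: "continuous_on {0..T} x" and x_bound: "\<And>s. s \<in> {0..T} \<Longrightarrow> norm (x s) \<le> R"
  shows "memory_term g x \<in> borel_measurable (lebesgue_on {0..T})"
    and "\<exists>N'. negligible N' \<and> (\<forall>t\<in>{0..T} - N'. (\<lambda>s. g t s (x s)) absolutely_integrable_on {0..t} \<and>
           memory_term g x t = integral {0..t} (\<lambda>s. g t s (x s)))"
proof -
  let ?x = "\<lambda>s. indicator {0..T} s *\<^sub>R x s"
  have x: "?x \<in> borel_measurable borel"
    using x_continuous by (intro borel_measurable_continuous_on_indicator) auto
  have xR: "norm (?x s) \<le> R" if "s \<in> {0..T}" for s
    using x_bound[OF that] that by simp
  have eq: "memory_term g ?x t = memory_term g x t" if "t \<in> {0..T}" for t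
    unfolding memory_term_def set_lebesgue_integral_def
    using that by (intro Bochner_Integration.integral_cong) (auto simp: indicator_def)
  show "memory_term g x \<in> borel_measurable (lebesgue_on {0..T})"
    using memory_term_integrable(1)[OF x xR] eq by (subst measurable_cong[of _ _ "memory_term g ?x"]) auto
  obtain N' where N': "negligible N'" "\<And>t. t \<in> {0..T} - N' \<Longrightarrow>
      (\<lambda>s. g t s (?x s)) absolutely_integrable_on {0..t} \<and> memory_term g ?x t = integral {0..t} (\<lambda>s. g t s (?x s))"
    using memory_term_integrable(3)[OF x xR] by blast
  have "(\<lambda>s. g t s (x s)) absolutely_integrable_on {0..t} \<and> memory_term g x t = integral {0..t} (\<lambda>s. g t s (x s))"
    if t: "t \<in> {0..T} - N'" for t
  proof -
    have *: "g t s (x s) = g t s (?x s)" if "s \<in> {0..t}" for s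
      using that t by simp
    then have "integral {0..t} (\<lambda>s. g t s (x s)) = integral {0..t} (\<lambda>s. g t s (?x s))"
      by (rule Henstock_Kurzweil_Integration.integral_cong)
    moreover have "(\<lambda>s. g t s (x s)) absolutely_integrable_on {0..t}"
      using * by (intro absolutely_integrable_spike[OF conjunct1[OF N'(2)[OF t]] negligible_empty]) auto
    ultimately show ?thesis using N'(2)[OF t] eq t by simp
  qed
  then show "\<exists>N'. negligible N' \<and> (\<forall>t\<in>{0..T} - N'. (\<lambda>s. g t s (x s)) absolutely_integrable_on {0..t} \<and>
           memory_term g x t = integral {0..t} (\<lambda>s. g t s (x s)))"
    using N'(1) by blast
qed

text \<open>The velocity of \<open>xbar\<close> enters through integrals over subintervals, so the
  error estimates need no derivatives. \<open>N\<close> gathers the exceptional times of the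
  inclusion and of the continuity of \<open>F\<close>, the latter stated as mutual nearness of
  points. The bound on \<open>ubar\<close> holds on \<open>N\<close> as well.\<close>

locale scheme_solution = scheme_data T m l \<beta> F g x0
  for T m l \<beta> :: real
    and F :: "real \<Rightarrow> real ^ 'n \<Rightarrow> (real ^ 'n) set"
    and g :: "real \<Rightarrow> real \<Rightarrow> real ^ 'n \<Rightarrow> real ^ 'n"
    and x0 :: "real ^ 'n" +
  fixes xbar ubar :: "real \<Rightarrow> real ^ 'n" and N :: "real set" and R :: real
  assumes xbar_continuous: "continuous_on {0..T} xbar"
    and xbar_bound: "t \<in> {0..T} \<Longrightarrow> norm (xbar t) \<le> R"
    and xbar_0: "xbar 0 = x0"
    and ubar_measurable: "ubar \<in> borel_measurable (lebesgue_on {0..T})"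
    and ubar_bound: "t \<in> {0..T} \<Longrightarrow> norm (ubar t) \<le> m"
    and negligible_N: "negligible N"
    and ubar_in: "t \<in> {0..T} - N \<Longrightarrow> ubar t \<in> F t (xbar t)"
    and xbar_increment: "0 \<le> a \<Longrightarrow> a \<le> b \<Longrightarrow> b \<le> T \<Longrightarrow>
          ((\<lambda>t. ubar t + memory_term g xbar t) has_integral (xbar b - xbar a)) {a..b}"
    and F_continuous: "t \<in> {0..T} - N \<Longrightarrow> \<epsilon> > 0 \<Longrightarrow> \<exists>\<delta>>0. \<forall>t'\<in>{0..T}. \<bar>t' - t\<bar> < \<delta> \<longrightarrow>
          (\<forall>x. (\<forall>a\<in>F t' x. \<exists>b\<in>F t x. norm (a - b) \<le> \<epsilon>) \<and> (\<forall>b\<in>F t x. \<exists>a\<in>F t' x. norm (b - a) \<le> \<epsilon>))"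
begin

abbreviation ybar :: "real \<Rightarrow> real ^ 'n" where "ybar \<equiv> memory_term g xbar"

text \<open>Bound of the velocity \<open>ubar t + ybar t\<close>, and hence a Lipschitz constant of
  \<open>xbar\<close>.\<close>

definition speed :: real where "speed = m + \<beta> * (1 + R) * T"

lemma R_nonneg: "0 \<le> R"
  using xbar_bound[of 0] T_pos norm_ge_zero[of "xbar 0"] by (simp del: norm_ge_zero)

lemma speed_nonneg: "0 \<le> speed"
  using m_nonneg beta_nonneg R_nonneg T_pos by (simp add: speed_def)

lemma ybar_bound: "t \<in> {0..T} \<Longrightarrow> norm (ybar t) \<le> \<beta> * (1 + R) * T"
  using xbar_bound by (intro norm_memory_term_le_growth) auto

lemmas ybar_regular = memory_term_regular[OF xbar_continuous, OF xbar_bound]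

lemma ubar_integrable: "ubar absolutely_integrable_on {0..T}"
  by (rule bounded_measurable_absolutely_integrable[OF ubar_measurable ubar_bound])

lemma ybar_integrable: "ybar absolutely_integrable_on {0..T}"
  by (rule bounded_measurable_absolutely_integrable[OF ybar_regular(1) ybar_bound])

lemma xbar_lipschitz:
  assumes "s \<in> {0..T}" "t \<in> {0..T}"
  shows "norm (xbar s - xbar t) \<le> speed * \<bar>s - t\<bar>"
proof -
  have le: "norm (xbar b - xbar a) \<le> speed * (b - a)" if ab: "0 \<le> a" "a \<le> b" "b \<le> T" for a b
  proof -
    have hi: "((\<lambda>t. ubar t + ybar t) has_integral (xbar b - xbar a)) (cbox a b)"
      using xbar_increment[OF ab] by simp
    have "norm (xbar b - xbar a) \<le> speed * measure lborel (cbox a b)"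
    proof (rule has_integral_bound[OF speed_nonneg hi])
      fix t assume "t \<in> cbox a b"
      then have t: "t \<in> {0..T}" using ab by auto
      show "norm (ubar t + ybar t) \<le> speed"
        using norm_triangle_ineq[of "ubar t" "ybar t"] ubar_bound[OF t] ybar_bound[OF t] by (simp add: speed_def)
    qed
    then show ?thesis using ab by simp
  qed
  show ?thesis
    using le[of s t] le[of t s] assms by (cases "s \<le> t") (auto simp: norm_minus_commute)
qed

text \<open>Largest excess of \<open>F t x\<close> over \<open>F (grid T k j) x\<close>, one-sided
  because it carries \<open>ubar t\<close> from time \<open>t\<close> to the node. The supremum over
  all \<open>x\<close> makes it independent of the scheme, and constancy on cells makes it
  measurable in time without further argument.\<close>

definition osc :: "nat \<Rightarrow> nat \<Rightarrow> real" where
  "osc k j = (SUP (t, x, a) \<in> {(t, x, a). t \<in> {grid T k j..grid T k (Suc j)} \<and> a \<in> F t x}. infdist a (F (grid T k j) x))"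

lemma infdist_F_le:
  assumes "t \<in> {0..T}" "s \<in> {0..T}" "a \<in> F t x"
  shows "infdist a (F s x) \<le> 2 * m"
proof -
  obtain y where y: "y \<in> F s x" using F_nonempty[OF assms(2)] by blast
  have "infdist a (F s x) \<le> dist a y" by (rule infdist_le[OF y])
  also have "\<dots> \<le> norm a + norm y" by (simp add: dist_norm norm_triangle_ineq4)
  finally show ?thesis using F_bound[OF assms(1,3)] F_bound[OF assms(2) y] by simp
qed

lemma osc_upper:
  assumes j: "j < k" and t: "t \<in> {grid T k j..grid T k (Suc j)}" and a: "a \<in> F t x"
  shows "infdist a (F (grid T k j) x) \<le> osc k j"
proof -
  let ?S = "{(t, x, a). t \<in> {grid T k j..grid T k (Suc j)} \<and> a \<in> F t x}"
  have "bdd_above ((\<lambda>(t, x, a). infdist a (F (grid T k j) x)) ` ?S)"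
  proof (rule bdd_aboveI2[where M = "2 * m"], clarify)
    fix t x a assume "t \<in> {grid T k j..grid T k (Suc j)}" "a \<in> F t x"
    then show "infdist a (F (grid T k j) x) \<le> 2 * m"
      using cell_subset[OF T_pos j] by (intro infdist_F_le[OF _ grid_in[OF j]]) auto
  qed
  from cSUP_upper[OF _ this, of "(t, x, a)"] show ?thesis
    using t a by (simp add: osc_def)
qed

lemma osc_le:
  assumes j: "j < k"
    and le: "\<And>t x a. t \<in> {grid T k j..grid T k (Suc j)} \<Longrightarrow> a \<in> F t x \<Longrightarrow> infdist a (F (grid T k j) x) \<le> e"
  shows "osc k j \<le> e"
proof -
  obtain a where "a \<in> F (grid T k j) undefined" using F_nonempty[OF grid_in[OF j]] by blast
  then have "(grid T k j, undefined, a) \<in> {(t, x, a). t \<in> {grid T k j..grid T k (Suc j)} \<and> a \<in> F t x}"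
    using T_pos by (simp add: grid_Suc)
  then show ?thesis
    unfolding osc_def using le by (intro cSUP_least) auto
qed

lemma osc_bounds:
  assumes j: "j < k"
  shows "0 \<le> osc k j" "osc k j \<le> 2 * m"
proof -
  obtain a where "a \<in> F (grid T k j) undefined" using F_nonempty[OF grid_in[OF j]] by blast
  then have "infdist a (F (grid T k j) undefined) \<le> osc k j"
    using T_pos by (intro osc_upper[OF j]) (auto simp: grid_Suc)
  then show "0 \<le> osc k j" using infdist_nonneg order_trans by blast
  show "osc k j \<le> 2 * m"
    using infdist_F_le[OF _ grid_in[OF j]] cell_subset[OF T_pos j] by (intro osc_le[OF j]) blast
qed

lemma osc_near:
  assumes j: "j < k" and t: "t \<in> {grid T k j..grid T k (Suc j)}" and a: "a \<in> F t x"
  obtains y where "y \<in> F (grid T k j) x" "norm (a - y) \<le> osc k j"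
proof -
  obtain y where "y \<in> F (grid T k j) x" "infdist a (F (grid T k j) x) = dist a y"
    using infdist_attains_inf[OF F_closed[OF grid_in[OF j]] F_nonempty[OF grid_in[OF j]]] by blast
  with osc_upper[OF j t a] show thesis by (intro that[of y]) (auto simp: dist_norm)
qed

text \<open>Continuity is available at \<open>t\<close> but perhaps not at the node, so both sets
  are compared with \<open>F t x\<close>. This costs \<open>e / 3\<close> twice once the cell is
  shorter than \<open>d\<close>.\<close>

lemma osc_tendsto:
  assumes t: "t \<in> {0..T} - N"
  shows "(\<lambda>k. osc (Suc k) (cell_index T (Suc k) t)) \<longlonglongrightarrow> 0"
proof (rule LIMSEQ_I)
  fix e :: real assume e: "e > 0"
  then obtain d where d: "d > 0" and near: "\<And>t'. t' \<in> {0..T} \<Longrightarrow> \<bar>t' - t\<bar> < d \<Longrightarrow>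
      (\<forall>x. (\<forall>a\<in>F t' x. \<exists>b\<in>F t x. norm (a - b) \<le> e / 3) \<and> (\<forall>b\<in>F t x. \<exists>a\<in>F t' x. norm (b - a) \<le> e / 3))"
    using F_continuous[OF t, of "e / 3"] by auto
  obtain K where K: "T / d < real K" using reals_Archimedean2 by blast
  show "\<exists>K. \<forall>k\<ge>K. norm (osc (Suc k) (cell_index T (Suc k) t) - 0) < e"
  proof (intro exI[of _ K] allI impI)
    fix k assume "k \<ge> K"
    then have "T / d < real (Suc k)" using K by linarith
    then have h: "T / real (Suc k) < d" using d T_pos by (simp add: field_simps del: of_nat_Suc)
    let ?j = "cell_index T (Suc k) t"
    have tT: "t \<in> {0..T}" using t by simp
    have j: "?j < Suc k" and tj: "t \<in> {grid T (Suc k) ?j..grid T (Suc k) (Suc ?j)}"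
      using cell_index_less[OF T_pos _ tT, of "Suc k"] by auto
    have close: "\<bar>s - t\<bar> < d" if "s \<in> {grid T (Suc k) ?j..grid T (Suc k) (Suc ?j)}" for s
      using that tj h unfolding grid_Suc by (auto simp del: of_nat_Suc)
    have "osc (Suc k) ?j \<le> 2 * (e / 3)"
    proof (rule osc_le[OF j])
      fix s x a assume s: "s \<in> {grid T (Suc k) ?j..grid T (Suc k) (Suc ?j)}" and a: "a \<in> F s x"
      have "s \<in> {0..T}" using s cell_subset[OF T_pos j] by blast
      from near[OF this close[OF s]] a obtain b where b: "b \<in> F t x" "norm (a - b) \<le> e / 3" by blast
      have "grid T (Suc k) ?j \<in> {grid T (Suc k) ?j..grid T (Suc k) (Suc ?j)}"
        using T_pos by (simp add: grid_Suc del: of_nat_Suc)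
      from near[OF grid_in[OF j] close[OF this]] b(1)
      obtain y where y: "y \<in> F (grid T (Suc k) ?j) x" "norm (b - y) \<le> e / 3" by blast
      have "infdist a (F (grid T (Suc k) ?j) x) \<le> norm (a - y)"
        using infdist_le[OF y(1), of a] by (simp add: dist_norm)
      also have "\<dots> \<le> norm (a - b) + norm (b - y)" using norm_triangle_ineq[of "a - b" "b - y"] by simp
      finally show "infdist a (F (grid T (Suc k) ?j) x) \<le> 2 * (e / 3)" using b(2) y(2) by simp
    qed
    with e osc_bounds(1)[OF j] show "norm (osc (Suc k) ?j - 0) < e" by simp
  qed
qed

text \<open>Dominated convergence with the bound \<open>2 * m\<close>. This is where continuity of
  \<open>F\<close> at almost every time, uniform in the state, is used.\<close>

lemma osc_integral_tendsto:
  "(\<lambda>k. integral {0..T} (\<lambda>t. osc k (cell_index T k t))) \<longlonglongrightarrow> 0"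
proof (rule LIMSEQ_imp_Suc)
  \<comment> \<open>Zero on \<open>N\<close> makes the convergence hold at every \<open>t\<close>;
    \<open>Suc k\<close> avoids the mesh without cells.\<close>
  let ?f = "\<lambda>k t. if t \<in> N then 0 else osc (Suc k) (cell_index T (Suc k) t)"
  have "(\<lambda>k. integral {0..T} (?f k)) \<longlonglongrightarrow> integral {0..T} (\<lambda>_. 0::real)"
  proof (rule dominated_convergence(2))
    show "?f k integrable_on {0..T}" for k
    proof (rule integrable_spike[OF _ negligible_N])
      show "(\<lambda>t. osc (Suc k) (cell_index T (Suc k) t)) integrable_on {0..T}"
        using step_absolutely_integrable[OF T_pos, of "Suc k" "osc (Suc k)"]
        by (auto dest: set_lebesgue_integral_eq_integral(1))
    qed auto
    show "norm (?f k t) \<le> 2 * m" if "t \<in> {0..T}" for k t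
      using osc_bounds[OF cell_index_less(1)[OF T_pos _ that]] m_nonneg by auto
    show "(\<lambda>k. ?f k t) \<longlonglongrightarrow> 0" if "t \<in> {0..T}" for t
      using osc_tendsto[of t] that by (cases "t \<in> N") auto
  qed auto
  moreover have "integral {0..T} (?f k) = integral {0..T} (\<lambda>t. osc (Suc k) (cell_index T (Suc k) t))" for k
    by (rule integral_spike[OF negligible_N]) auto
  ultimately show "(\<lambda>k. integral {0..T} (\<lambda>t. osc (Suc k) (cell_index T (Suc k) t))) \<longlonglongrightarrow> 0"
    by simp
qed

text \<open>Lipschitz constant of \<open>g\<close> on a ball that contains the nodes of every
  scheme, by \<open>scheme_bounded\<close>, and the range of \<open>xbar\<close>.\<close>

definition alpha :: real where
  "alpha = (SOME \<alpha>. \<alpha> \<ge> 0 \<and> (\<forall>t\<in>{0..T}. \<forall>s\<in>{0..t}. \<forall>x\<in>cball 0 (scheme_bound + R). \<forall>y\<in>cball 0 (scheme_bound + R).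
          norm (g t s x - g t s y) \<le> \<alpha> * norm (x - y)))"

lemma scheme_bound_pos: "scheme_bound > 0"
  unfolding scheme_bound_def by (intro mult_pos_pos add_pos_nonneg) auto

lemma alpha:
  shows "alpha \<ge> 0"
    and "t \<in> {0..T} \<Longrightarrow> s \<in> {0..t} \<Longrightarrow> norm x \<le> scheme_bound + R \<Longrightarrow> norm y \<le> scheme_bound + R \<Longrightarrow>
      norm (g t s x - g t s y) \<le> alpha * norm (x - y)"
proof -
  have "scheme_bound + R > 0" using scheme_bound_pos R_nonneg by simp
  from g_lipschitz[OF this]
  have ex: "\<exists>\<alpha>. \<alpha> \<ge> 0 \<and> (\<forall>t\<in>{0..T}. \<forall>s\<in>{0..t}. \<forall>x\<in>cball 0 (scheme_bound + R). \<forall>y\<in>cball 0 (scheme_bound + R).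
          norm (g t s x - g t s y) \<le> \<alpha> * norm (x - y))" by blast
  note * = someI_ex[OF ex, folded alpha_def]
  show "alpha \<ge> 0" using * by blast
  show "t \<in> {0..T} \<Longrightarrow> s \<in> {0..t} \<Longrightarrow> norm x \<le> scheme_bound + R \<Longrightarrow> norm y \<le> scheme_bound + R \<Longrightarrow>
      norm (g t s x - g t s y) \<le> alpha * norm (x - y)"
    using conjunct2[OF *] by (metis mem_cball_0)
qed

text \<open>Both vectors are cell means of memory terms, so it suffices to compare the integrands.
  At \<open>s\<close> the step function differs from \<open>xbar s\<close> by the error
  \<open>E\<close> at the node plus the motion of \<open>xbar\<close> inside a cell. Only nodes up
  to \<open>j\<close> enter, in accordance with \<open>discrete_gronwall\<close>.\<close>

lemma memory_close:
  assumes k: "k \<ge> 1" and sch: "is_scheme k \<xi> u w" and j: "j < k"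
    and E: "\<And>i. i \<le> j \<Longrightarrow> norm (\<xi> i - xbar (grid T k i)) \<le> E"
  shows "norm (w j - cell_mean T k ybar j) \<le> alpha * (E + speed * (T / real k)) * T"
proof -
  let ?z = "step_fun k \<xi>" and ?J = "{grid T k j..grid T k (Suc j)}"
  let ?M = "memory_term g ?z" and ?C = "alpha * (E + speed * (T / real k))"
  have E0: "0 \<le> E" using E[of 0] norm_ge_zero[of "\<xi> 0 - xbar (grid T k 0)"] by (simp del: norm_ge_zero)
  have C0: "0 \<le> ?C" using alpha(1) E0 speed_nonneg T_pos by simp
  have z: "?z \<in> borel_measurable borel" by measurable
  note mi = memory_term_integrable[OF z norm_step_fun_le[OF k]]
  obtain N1 where N1: "negligible N1" "\<And>t. t \<in> {0..T} - N1 \<Longrightarrow> (\<lambda>s. g t s (?z s)) absolutely_integrable_on {0..t} \<and>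
           ?M t = integral {0..t} (\<lambda>s. g t s (?z s))"
    using mi(3) by blast
  obtain N2 where N2: "negligible N2" "\<And>t. t \<in> {0..T} - N2 \<Longrightarrow> (\<lambda>s. g t s (xbar s)) absolutely_integrable_on {0..t} \<and>
           ybar t = integral {0..t} (\<lambda>s. g t s (xbar s))"
    using ybar_regular(2) by blast
  have sub: "?J \<subseteq> {0..T}" by (rule cell_subset[OF T_pos j])
  have Mint: "?M integrable_on ?J" and yint: "ybar integrable_on ?J"
    using absolutely_integrable_on_subinterval[OF mi(2) sub] absolutely_integrable_on_subinterval[OF ybar_integrable sub]
    by (auto dest: set_lebesgue_integral_eq_integral(1))
  have "norm (cell_mean T k (\<lambda>t. ?M t - ybar t) j - 0) \<le> ?C * T"
  proof (rule cell_mean_dist_le[OF T_pos k integrable_diff[OF Mint yint]])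
    show "negligible (N1 \<union> N2)" using N1(1) N2(1) by simp
    show "0 \<le> ?C * T" using C0 T_pos by simp
    fix t assume t: "t \<in> ?J - (N1 \<union> N2)"
    then have t1: "t \<in> {0..T} - N1" and t2: "t \<in> {0..T} - N2" and tT: "t \<in> {0..T}" using sub by auto
    have int1: "(\<lambda>s. g t s (?z s)) integrable_on {0..t}" and int2: "(\<lambda>s. g t s (xbar s)) integrable_on {0..t}"
      using N1(2)[OF t1] N2(2)[OF t2] by (auto dest: set_lebesgue_integral_eq_integral(1))
    have "norm (?M t - ybar t) = norm (integral {0..t} (\<lambda>s. g t s (?z s) - g t s (xbar s)))"
      using N1(2)[OF t1] N2(2)[OF t2] integral_diff[OF int1 int2] by simp
    also have "\<dots> \<le> integral {0..t} (\<lambda>s. ?C)"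
    proof (intro integral_norm_bound_integral integrable_diff int1 int2)
      fix s assume s: "s \<in> {0..t}"
      let ?i = "cell_index T k s"
      have sT: "s \<in> {0..T}" using s tT by auto
      have i: "?i \<le> j" using s t by (intro cell_index_le[OF k sT]) auto
      have ik: "?i < k" and si: "s \<in> {grid T k ?i..grid T k (Suc ?i)}" using cell_index_less[OF T_pos k sT] by auto
      have "norm (xbar (grid T k ?i) - xbar s) \<le> speed * \<bar>grid T k ?i - s\<bar>"
        by (rule xbar_lipschitz[OF grid_in[OF ik] sT])
      also have "\<dots> \<le> speed * (T / real k)"
        using si speed_nonneg by (intro mult_left_mono) (auto simp: grid_Suc)
      finally have "norm (\<xi> ?i - xbar s) \<le> E + speed * (T / real k)"
        using E[OF i] norm_triangle_ineq[of "\<xi> ?i - xbar (grid T k ?i)" "xbar (grid T k ?i) - xbar s"] by simp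
      then have "alpha * norm (\<xi> ?i - xbar s) \<le> ?C" using alpha(1) by (rule mult_left_mono)
      moreover have "norm (g t s (\<xi> ?i) - g t s (xbar s)) \<le> alpha * norm (\<xi> ?i - xbar s)"
        using scheme_bounded[OF k sch, of ?i] ik xbar_bound[OF sT] R_nonneg scheme_bound_pos
        by (intro alpha(2)[OF tT s]) auto
      ultimately show "norm (g t s (?z s) - g t s (xbar s)) \<le> ?C" by simp
    qed auto
    also have "\<dots> = ?C * t" using tT by (simp add: mult.commute)
    also have "\<dots> \<le> ?C * T" using tT C0 by (intro mult_left_mono) auto
    finally show "norm (?M t - ybar t - 0) \<le> ?C * T" by simp
  qed
  moreover have "cell_mean T k (\<lambda>t. ?M t - ybar t) j = w j - cell_mean T k ybar j"
    using sch j discrete_memory_eq_cell_mean[OF k j] integral_diff[OF Mint yint]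
    by (simp add: is_scheme_def cell_mean_def scaleR_diff_right)
  ultimately show ?thesis by simp
qed

end

section \<open>Error estimates for the nearest-point scheme\<close>

context scheme_solution
begin

text \<open>Total source of the Gronwall recursion: averaging error of \<open>ubar\<close>,
  oscillation of \<open>F\<close> in time, and motion of \<open>xbar\<close> within cells as felt by
  \<open>F\<close> (rate \<open>l\<close>) and by the memory (rate \<open>alpha * T\<close>). The
  factor 2 comes from \<open>u_cell_close\<close>.\<close>

definition residual :: "nat \<Rightarrow> real" where
  "residual k = 2 * integral {0..T} (\<lambda>t. norm (cell_mean T k ubar (cell_index T k t) - ubar t)) +
     integral {0..T} (\<lambda>t. osc k (cell_index T k t)) + T * (T / real k) * (speed * (l + alpha * T))"

definition growth :: real where "growth = exp ((l + alpha * T) * T)"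

lemma residual_tendsto: "residual \<longlonglongrightarrow> 0"
proof -
  have "residual \<longlonglongrightarrow> 2 * 0 + 0 + T * 0 * (speed * (l + alpha * T))"
    unfolding residual_def
    by (intro tendsto_intros cell_mean_L1_convergence[OF T_pos ubar_measurable ubar_bound]
        osc_integral_tendsto lim_const_over_n)
  then show ?thesis by simp
qed

lemma ubar_cell_integrable:
  assumes "j < k"
  shows "ubar integrable_on {grid T k j..grid T k (Suc j)}"
    and "(\<lambda>t. norm (c - ubar t)) integrable_on {grid T k j..grid T k (Suc j)}"
proof -
  have *: "ubar absolutely_integrable_on {grid T k j..grid T k (Suc j)}"
    by (rule absolutely_integrable_on_subinterval[OF ubar_integrable cell_subset[OF T_pos assms]])
  then show "ubar integrable_on {grid T k j..grid T k (Suc j)}"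
    by (rule set_lebesgue_integral_eq_integral(1))
  have "(\<lambda>t. c - ubar t) absolutely_integrable_on {grid T k j..grid T k (Suc j)}"
    by (intro set_integral_diff(1) * ) auto
  then show "(\<lambda>t. norm (c - ubar t)) integrable_on {grid T k j..grid T k (Suc j)}"
    by (simp add: absolutely_integrable_on_def)
qed

text \<open>For almost every \<open>t\<close>, \<open>ubar t\<close> is moved to a point
  \<open>y\<close> of \<open>F (grid T k j) (\<xi> j)\<close>: first in time at cost
  \<open>osc k j\<close>, then in state at cost \<open>l\<close> times the distance. Minimality of
  \<open>u j\<close> against \<open>y\<close> and two triangle inequalities through \<open>p\<close>
  produce the factor 2. The competitor \<open>y\<close> varies with \<open>t\<close>, so no mean of
  points of \<open>F\<close> has to lie in \<open>F\<close>.\<close>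

lemma u_cell_close:
  assumes sch: "is_scheme k \<xi> u w" and j: "j < k"
    and near: "\<And>y. y \<in> F (grid T k j) (\<xi> j) \<Longrightarrow> norm (u j - p) \<le> norm (y - p)"
  shows "integral {grid T k j..grid T k (Suc j)} (\<lambda>t. norm (u j - ubar t)) \<le>
     2 * integral {grid T k j..grid T k (Suc j)} (\<lambda>t. norm (p - ubar t)) +
     (T / real k) * (osc k j + l * (norm (\<xi> j - xbar (grid T k j)) + speed * (T / real k)))"
proof -
  let ?J = "{grid T k j..grid T k (Suc j)}"
  let ?B = "osc k j + l * (norm (\<xi> j - xbar (grid T k j)) + speed * (T / real k))"
  let ?h = "\<lambda>t. if t \<in> N then 0 else norm (u j - ubar t)"
  note int = ubar_cell_integrable(2)[OF j]
  have B0: "0 \<le> ?B" using osc_bounds(1)[OF j] l_nonneg speed_nonneg T_pos by simp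
  have pt: "norm (u j - ubar t) \<le> 2 * norm (p - ubar t) + ?B" if t: "t \<in> ?J - N" for t
  proof -
    have tT: "t \<in> {0..T}" using t cell_subset[OF T_pos j] by blast
    then have "ubar t \<in> F t (xbar t)" using t by (intro ubar_in) auto
    then obtain y1 where y1: "y1 \<in> F (grid T k j) (xbar t)" "norm (ubar t - y1) \<le> osc k j"
      using osc_near[OF j _ \<open>ubar t \<in> F t (xbar t)\<close>] t by blast
    obtain y where y: "y \<in> F (grid T k j) (\<xi> j)" "norm (y1 - y) \<le> l * norm (xbar t - \<xi> j)"
      using F_lipschitz[OF grid_in[OF j] y1(1)] by blast
    have "norm (xbar t - xbar (grid T k j)) \<le> speed * \<bar>t - grid T k j\<bar>"
      by (rule xbar_lipschitz[OF tT grid_in[OF j]])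
    also have "\<dots> \<le> speed * (T / real k)"
      using t speed_nonneg by (intro mult_left_mono) (auto simp: grid_Suc)
    finally have "norm (xbar t - \<xi> j) \<le> norm (\<xi> j - xbar (grid T k j)) + speed * (T / real k)"
      using norm_triangle_ineq4[of "xbar t - xbar (grid T k j)" "\<xi> j - xbar (grid T k j)"] by simp
    then have "l * norm (xbar t - \<xi> j) \<le> l * (norm (\<xi> j - xbar (grid T k j)) + speed * (T / real k))"
      using l_nonneg by (rule mult_left_mono)
    then have "norm (ubar t - y) \<le> ?B"
      using y(2) y1(2) norm_triangle_ineq[of "ubar t - y1" "y1 - y"] by simp
    moreover have "norm (u j - p) \<le> norm (y - p)" by (rule near[OF y(1)])
    moreover have "norm (y - p) \<le> norm (ubar t - y) + norm (p - ubar t)"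
      using norm_triangle_ineq[of "ubar t - y" "p - ubar t"] by (simp add: norm_minus_commute)
    moreover have "norm (u j - ubar t) \<le> norm (u j - p) + norm (p - ubar t)"
      using norm_triangle_ineq[of "u j - p" "p - ubar t"] by simp
    ultimately show ?thesis by linarith
  qed
  have int2: "(\<lambda>t. 2 * norm (p - ubar t)) integrable_on ?J"
    using int by (intro integrable_on_mult_right) auto
  have "integral ?J (\<lambda>t. norm (u j - ubar t)) = integral ?J ?h"
    by (rule integral_spike[OF negligible_N]) auto
  also have "\<dots> \<le> integral ?J (\<lambda>t. 2 * norm (p - ubar t) + ?B)"
  proof (rule integral_le)
    show "?h integrable_on ?J"
      by (rule integrable_spike[OF int[of "u j"] negligible_N]) auto
    show "(\<lambda>t. 2 * norm (p - ubar t) + ?B) integrable_on ?J"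
      by (rule integrable_add[OF int2 integrable_const_ivl])
    show "?h t \<le> 2 * norm (p - ubar t) + ?B" if "t \<in> ?J" for t
      using pt[of t] that B0 by auto
  qed
  also have "\<dots> = integral ?J (\<lambda>t. 2 * norm (p - ubar t)) + integral ?J (\<lambda>t. ?B)"
    by (rule integral_add[OF int2]) auto
  also have "integral ?J (\<lambda>t. ?B) = (T / real k) * ?B"
    using T_pos by (simp add: grid_Suc)
  finally show ?thesis by simp
qed

text \<open>Splits the global quantity into the source terms of the single Gronwall steps.\<close>

lemma residual_eq_sum:
  assumes k: "k \<ge> 1"
  shows "residual k = (\<Sum>j<k. 2 * integral {grid T k j..grid T k (Suc j)} (\<lambda>t. norm (cell_mean T k ubar j - ubar t)) +
     (T / real k) * (osc k j + speed * (l + alpha * T) * (T / real k)))"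
proof -
  let ?f = "\<lambda>t. norm (cell_mean T k ubar (cell_index T k t) - ubar t)"
  have "?f integrable_on {0..T}"
    using set_integral_diff(1)[OF step_absolutely_integrable[OF T_pos k] ubar_integrable]
    by (simp add: absolutely_integrable_on_def)
  then have "integral {0..T} ?f = (\<Sum>j<k. integral {grid T k j..grid T k (Suc j)} ?f)"
    using integral_cells[OF T_pos, of ?f k k] k by simp
  also have "\<dots> = (\<Sum>j<k. integral {grid T k j..grid T k (Suc j)} (\<lambda>t. norm (cell_mean T k ubar j - ubar t)))"
    using integral_cell_cong[OF T_pos k, of _ "\<lambda>j t. norm (cell_mean T k ubar j - ubar t)"] by simp
  finally have 1: "integral {0..T} ?f = \<dots>" .
  have 2: "integral {0..T} (\<lambda>t. osc k (cell_index T k t)) = (\<Sum>j<k. (T / real k) * osc k j)"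
    using integral_step[OF T_pos k, of "osc k"] by simp
  have 3: "T * (T / real k) * (speed * (l + alpha * T)) = (\<Sum>j<k. (T / real k) * (speed * (l + alpha * T) * (T / real k)))"
    using k by simp
  show ?thesis
    unfolding residual_def 1 2 3 by (simp only: sum.distrib sum_distrib_left distrib_left add.assoc)
qed

context
  fixes k :: nat and \<xi> u w :: "nat \<Rightarrow> real ^ 'n"
  assumes k: "k \<ge> 1" and sch: "is_scheme k \<xi> u w"
    and near: "\<And>j y. j < k \<Longrightarrow> y \<in> F (grid T k j) (\<xi> j) \<Longrightarrow>
      norm (u j - cell_mean T k ubar j) \<le> norm (y - cell_mean T k ubar j)"
begin

text \<open>One step changes the node error by the integral of \<open>u j - ubar t\<close> plus the
  step length times the memory error. The first is bounded by \<open>u_cell_close\<close>, the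
  second by \<open>memory_close\<close>; the coefficients of \<open>E\<close> add up to
  \<open>(T / real k) * (l + alpha * T)\<close>.\<close>

lemma error_bound:
  assumes "j \<le> k"
  shows "norm (\<xi> j - xbar (grid T k j)) \<le> growth * residual k"
proof -
  let ?h = "T / real k"
  let ?J = "\<lambda>j. {grid T k j..grid T k (Suc j)}"
  let ?c = "\<lambda>j. 2 * integral (?J j) (\<lambda>t. norm (cell_mean T k ubar j - ubar t)) +
     ?h * (osc k j + speed * (l + alpha * T) * ?h)"
  have h: "?h \<ge> 0" using T_pos by simp
  have "norm (\<xi> j - xbar (grid T k j)) \<le> exp (?h * (l + alpha * T) * real k) * (0 + (\<Sum>i<k. ?c i))"
  proof (rule discrete_gronwall[OF _ _ _ _ _ assms])
    show "0 \<le> ?c j" if "j < k" for j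
      using osc_bounds(1)[OF that] speed_nonneg l_nonneg alpha(1) T_pos ubar_cell_integrable(2)[OF that]
      by (intro add_nonneg_nonneg mult_nonneg_nonneg integral_nonneg) auto
  next
    fix j E assume jk: "j < k" and E: "\<And>i. i \<le> j \<Longrightarrow> norm (\<xi> i - xbar (grid T k i)) \<le> E"
    have sub: "?J j \<subseteq> {0..T}" by (rule cell_subset[OF T_pos jk])
    note uint = ubar_cell_integrable(1)[OF jk]
    have yint: "ybar integrable_on ?J j"
      using absolutely_integrable_on_subinterval[OF ybar_integrable sub]
      by (rule set_lebesgue_integral_eq_integral(1))
    have "xbar (grid T k (Suc j)) - xbar (grid T k j) = integral (?J j) (\<lambda>t. ubar t + ybar t)"
      using xbar_increment[of "grid T k j" "grid T k (Suc j)"] grid_nonneg[OF T_pos] grid_mono[OF T_pos, of j "Suc j" k]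
        grid_le[OF T_pos k, of "Suc j"] jk by (simp add: integral_unique)
    also have "\<dots> = integral (?J j) ubar + integral (?J j) ybar" by (rule integral_add[OF uint yint])
    also have "integral (?J j) ybar = ?h *\<^sub>R cell_mean T k ybar j"
      using T_pos k by (simp add: cell_mean_def)
    \<comment> \<open>Writing the scheme's increment as the integral of a constant lets the error be
      estimated under the integral sign.\<close>
    also have "integral (?J j) ubar = ?h *\<^sub>R u j - integral (?J j) (\<lambda>t. u j - ubar t)"
      using T_pos by (simp add: integral_diff[OF integrable_const_ivl uint]) (simp add: grid_Suc)
    finally have "\<xi> (Suc j) - xbar (grid T k (Suc j)) = (\<xi> j - xbar (grid T k j)) +
        (integral (?J j) (\<lambda>t. u j - ubar t) + ?h *\<^sub>R (w j - cell_mean T k ybar j))"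
      using sch jk by (simp add: is_scheme_def algebra_simps)
    then have "norm (\<xi> (Suc j) - xbar (grid T k (Suc j))) \<le> norm (\<xi> j - xbar (grid T k j)) +
        (norm (integral (?J j) (\<lambda>t. u j - ubar t)) + norm (?h *\<^sub>R (w j - cell_mean T k ybar j)))"
      by (metis norm_triangle_ineq norm_triangle_mono order_refl)
    also have "norm (?h *\<^sub>R (w j - cell_mean T k ybar j)) \<le> ?h * (alpha * (E + speed * ?h) * T)"
      using mult_left_mono[OF memory_close[OF k sch jk E] h] h T_pos by simp
    also have "norm (integral (?J j) (\<lambda>t. u j - ubar t)) \<le> integral (?J j) (\<lambda>t. norm (u j - ubar t))"
      by (intro integral_norm_bound_integral integrable_diff integrable_const_ivl uint ubar_cell_integrable(2)[OF jk]) auto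
    also have "\<dots> \<le> 2 * integral (?J j) (\<lambda>t. norm (cell_mean T k ubar j - ubar t)) +
        ?h * (osc k j + l * (norm (\<xi> j - xbar (grid T k j)) + speed * ?h))"
      by (rule u_cell_close[OF sch jk near[OF jk]])
    also have "\<dots> \<le> 2 * integral (?J j) (\<lambda>t. norm (cell_mean T k ubar j - ubar t)) +
        ?h * (osc k j + l * (E + speed * ?h))"
      using E[of j] h l_nonneg by (intro add_left_mono mult_left_mono add_right_mono) auto
    finally have "norm (\<xi> (Suc j) - xbar (grid T k (Suc j))) \<le> norm (\<xi> j - xbar (grid T k j)) +
        (2 * integral (?J j) (\<lambda>t. norm (cell_mean T k ubar j - ubar t)) +
        ?h * (osc k j + l * (E + speed * ?h)) + ?h * (alpha * (E + speed * ?h) * T))"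
      by simp
    also have "\<dots> \<le> E + (2 * integral (?J j) (\<lambda>t. norm (cell_mean T k ubar j - ubar t)) +
        ?h * (osc k j + l * (E + speed * ?h)) + ?h * (alpha * (E + speed * ?h) * T))"
      using E[of j] by simp
    also have "\<dots> = (1 + ?h * (l + alpha * T)) * E + ?c j"
      by (simp add: algebra_simps del: times_divide_eq_left times_divide_eq_right)
    finally show "norm (\<xi> (Suc j) - xbar (grid T k (Suc j))) \<le> (1 + ?h * (l + alpha * T)) * E + ?c j" .
  qed (use sch h l_nonneg alpha(1) T_pos xbar_0 in \<open>auto simp: is_scheme_def\<close>)
  also have "exp (?h * (l + alpha * T) * real k) = growth"
    using k by (simp add: growth_def)
  finally show ?thesis by (simp only: residual_eq_sum[OF k] add_0)
qed

text \<open>With the node errors under control, \<open>u_cell_close\<close> is summed a second time,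
  now for the velocities.\<close>

lemma u_L1_bound:
  "integral {0..T} (\<lambda>t. norm (u (cell_index T k t) - ubar t)) \<le> residual k + T * (l * (growth * residual k))"
proof -
  let ?h = "T / real k" and ?f = "\<lambda>t. norm (u (cell_index T k t) - ubar t)"
  let ?J = "\<lambda>j. {grid T k j..grid T k (Suc j)}"
  have h: "?h \<ge> 0" using T_pos by simp
  have "?f integrable_on {0..T}"
    using set_integral_diff(1)[OF step_absolutely_integrable[OF T_pos k] ubar_integrable]
    by (simp add: absolutely_integrable_on_def)
  then have "integral {0..T} ?f = (\<Sum>j<k. integral (?J j) ?f)"
    using integral_cells[OF T_pos, of ?f k k] k by simp
  also have "\<dots> = (\<Sum>j<k. integral (?J j) (\<lambda>t. norm (u j - ubar t)))"
    using integral_cell_cong[OF T_pos k, of _ "\<lambda>j t. norm (u j - ubar t)"] by simp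
  also have "\<dots> \<le> (\<Sum>j<k. (2 * integral (?J j) (\<lambda>t. norm (cell_mean T k ubar j - ubar t)) +
     ?h * (osc k j + speed * (l + alpha * T) * ?h)) + ?h * (l * (growth * residual k)))"
  proof (rule sum_mono)
    fix j assume "j \<in> {..<k}"
    then have jk: "j < k" by simp
    have "l * (norm (\<xi> j - xbar (grid T k j)) + speed * ?h) \<le> l * (growth * residual k + speed * ?h)"
      using error_bound[of j] jk l_nonneg by (intro mult_left_mono) auto
    \<comment> \<open>Adding the nonnegative memory rate \<open>alpha * T\<close> produces exactly
      the summand of \<open>residual_eq_sum\<close>.\<close>
    also have "\<dots> \<le> l * (growth * residual k) + speed * (l + alpha * T) * ?h"
      using alpha(1) speed_nonneg T_pos h by (simp add: algebra_simps)
    finally have "?h * (osc k j + l * (norm (\<xi> j - xbar (grid T k j)) + speed * ?h)) \<le>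
        ?h * (osc k j + (l * (growth * residual k) + speed * (l + alpha * T) * ?h))"
      using h by (intro mult_left_mono) auto
    moreover have "integral (?J j) (\<lambda>t. norm (u j - ubar t)) \<le>
        2 * integral (?J j) (\<lambda>t. norm (cell_mean T k ubar j - ubar t)) +
        ?h * (osc k j + l * (norm (\<xi> j - xbar (grid T k j)) + speed * ?h))"
      by (rule u_cell_close[OF sch jk near[OF jk]])
    ultimately show "integral (?J j) (\<lambda>t. norm (u j - ubar t)) \<le>
      (2 * integral (?J j) (\<lambda>t. norm (cell_mean T k ubar j - ubar t)) +
     ?h * (osc k j + speed * (l + alpha * T) * ?h)) + ?h * (l * (growth * residual k))"
      unfolding distrib_left by linarith
  qed
  also have "\<dots> = residual k + T * (l * (growth * residual k))"
    unfolding sum.distrib[of _ "\<lambda>j. ?h * (l * (growth * residual k))"] residual_eq_sum[OF k, symmetric]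
    using k by simp
  finally show ?thesis .
qed

text \<open>The cell mean of \<open>ybar\<close> is the intermediate point:
  \<open>memory_close\<close> bounds the distance to it, and its distance to \<open>ybar\<close> is
  a pure averaging error.\<close>

lemma w_L1_bound:
  "integral {0..T} (\<lambda>t. norm (w (cell_index T k t) - ybar t)) \<le>
     integral {0..T} (\<lambda>t. norm (cell_mean T k ybar (cell_index T k t) - ybar t)) +
     alpha * (growth * residual k + speed * (T / real k)) * T * T"
proof -
  let ?C = "alpha * (growth * residual k + speed * (T / real k)) * T"
  have int: "(\<lambda>t. norm (a (cell_index T k t) - ybar t)) integrable_on {0..T}" for a :: "nat \<Rightarrow> real ^ 'n"
    using set_integral_diff(1)[OF step_absolutely_integrable[OF T_pos k] ybar_integrable]
    by (simp add: absolutely_integrable_on_def)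
  have "integral {0..T} (\<lambda>t. norm (w (cell_index T k t) - ybar t)) \<le>
     integral {0..T} (\<lambda>t. norm (cell_mean T k ybar (cell_index T k t) - ybar t) + ?C)"
  proof (intro integral_le integrable_add int integrable_const_ivl)
    fix t assume t: "t \<in> {0..T}"
    let ?j = "cell_index T k t"
    have j: "?j < k" using cell_index_less[OF T_pos k t] by simp
    have "norm (w ?j - cell_mean T k ybar ?j) \<le> ?C"
      using j by (intro memory_close[OF k sch j] error_bound) auto
    then show "norm (w ?j - ybar t) \<le> norm (cell_mean T k ybar ?j - ybar t) + ?C"
      using norm_triangle_ineq[of "w ?j - cell_mean T k ybar ?j" "cell_mean T k ybar ?j - ybar t"] by simp
  qed
  also have "\<dots> = integral {0..T} (\<lambda>t. norm (cell_mean T k ybar (cell_index T k t) - ybar t)) + ?C * T"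
    using T_pos by (simp add: integral_add[OF int integrable_const_ivl])
  finally show ?thesis .
qed

end

lemma scheme_converges:
  obtains \<xi> u w :: "nat \<Rightarrow> nat \<Rightarrow> real ^ 'n" and \<epsilon> :: "nat \<Rightarrow> real" where
    "\<And>k. k \<ge> 1 \<Longrightarrow> is_scheme k (\<xi> k) (u k) (w k)"
    "\<epsilon> \<longlonglongrightarrow> 0"
    "\<And>k j. k \<ge> 1 \<Longrightarrow> j \<le> k \<Longrightarrow> norm (\<xi> k j - xbar (grid T k j)) \<le> \<epsilon> k"
    "\<And>k. k \<ge> 1 \<Longrightarrow> integral {0..T} (\<lambda>t. norm (u k (cell_index T k t) - ubar t)) \<le> \<epsilon> k"
    "\<And>k. k \<ge> 1 \<Longrightarrow> integral {0..T} (\<lambda>t. norm (w k (cell_index T k t) - ybar t)) \<le> \<epsilon> k"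
proof -
  have "\<exists>\<xi> u w. is_scheme k \<xi> u w \<and> (\<forall>j y. j < k \<longrightarrow> y \<in> F (grid T k j) (\<xi> j) \<longrightarrow>
      norm (u j - cell_mean T k ubar j) \<le> norm (y - cell_mean T k ubar j))" for k
    by (rule scheme_exists[of k "cell_mean T k ubar"]) blast
  then obtain \<xi> u w where s: "\<And>k. is_scheme k (\<xi> k) (u k) (w k)"
    and near: "\<And>k j y. j < k \<Longrightarrow> y \<in> F (grid T k j) (\<xi> k j) \<Longrightarrow>
      norm (u k j - cell_mean T k ubar j) \<le> norm (y - cell_mean T k ubar j)"
    by metis
  let ?w = "\<lambda>k. integral {0..T} (\<lambda>t. norm (cell_mean T k ybar (cell_index T k t) - ybar t)) +
     alpha * (growth * residual k + speed * (T / real k)) * T * T"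
  define \<epsilon> where "\<epsilon> k = max (growth * residual k) (max (residual k + T * (l * (growth * residual k))) (?w k))" for k
  have "?w \<longlonglongrightarrow> 0 + alpha * (growth * 0 + speed * 0) * T * T"
    by (intro tendsto_intros cell_mean_L1_convergence[OF T_pos ybar_regular(1) ybar_bound]
        residual_tendsto lim_const_over_n)
  moreover have "(\<lambda>k. growth * residual k) \<longlonglongrightarrow> growth * 0"
    by (intro tendsto_intros residual_tendsto)
  moreover have "(\<lambda>k. residual k + T * (l * (growth * residual k))) \<longlonglongrightarrow> 0 + T * (l * (growth * 0))"
    by (intro tendsto_intros residual_tendsto)
  ultimately have "\<epsilon> \<longlonglongrightarrow> max (growth * 0) (max (0 + T * (l * (growth * 0))) (0 + alpha * (growth * 0 + speed * 0) * T * T))"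
    unfolding \<epsilon>_def by (intro tendsto_max)
  then have "\<epsilon> \<longlonglongrightarrow> 0" by simp
  then show thesis
  proof (rule that[OF s])
    show "norm (\<xi> k j - xbar (grid T k j)) \<le> \<epsilon> k" if "k \<ge> 1" "j \<le> k" for k j
      using error_bound[OF that(1) s near that(2)] by (simp add: \<epsilon>_def)
    show "integral {0..T} (\<lambda>t. norm (u k (cell_index T k t) - ubar t)) \<le> \<epsilon> k" if "k \<ge> 1" for k
      using u_L1_bound[OF that s near] by (simp add: \<epsilon>_def)
    show "integral {0..T} (\<lambda>t. norm (w k (cell_index T k t) - ybar t)) \<le> \<epsilon> k" if "k \<ge> 1" for k
      using w_L1_bound[OF that s near] by (simp add: \<epsilon>_def)
  qed
qed

end

section \<open>Reduction of the theorem to the scheme\<close>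

lemma AE_lebesgue_on_negligible:
  assumes "AE t in lebesgue_on {a..b::real}. P t"
  obtains N where "negligible N" "\<And>t. t \<in> {a..b} - N \<Longrightarrow> P t"
proof -
  have "AE t in lebesgue. t \<in> {a..b} \<longrightarrow> P t"
    using assms by (subst (asm) AE_restrict_space_iff) auto
  then show thesis
    unfolding eventually_ae_filter_negligible using that by blast
qed

lemma abs_continuous_on_subinterval:
  assumes "abs_continuous_on_interval a b f" "a \<le> c" "d \<le> b"
  shows "abs_continuous_on_interval c d f"
  unfolding abs_continuous_on_interval_def
proof (intro allI impI)
  fix e :: real assume e: "e > 0"
  obtain \<delta> where \<delta>: "\<delta> > 0" and le: "\<And>S :: (real \<times> real) set.
        finite S \<Longrightarrow> (\<forall>(u, v) \<in> S. a \<le> u \<and> u \<le> v \<and> v \<le> b) \<Longrightarrow>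
        pairwise (\<lambda>p q. disjnt {fst p<..<snd p} {fst q<..<snd q}) S \<Longrightarrow>
        (\<Sum>(u, v) \<in> S. v - u) < \<delta> \<Longrightarrow> (\<Sum>(u, v) \<in> S. norm (f v - f u)) < e"
    using abs_continuousE[OF assms(1) e] by blast
  show "\<exists>\<delta>>0. \<forall>S. finite S \<longrightarrow> (\<forall>(u, v)\<in>S. c \<le> u \<and> u \<le> v \<and> v \<le> d) \<longrightarrow>
      pairwise (\<lambda>p q. disjnt {fst p<..<snd p} {fst q<..<snd q}) S \<longrightarrow>
      (\<Sum>(u, v)\<in>S. v - u) < \<delta> \<longrightarrow> (\<Sum>(u, v)\<in>S. norm (f v - f u)) < e"
  proof (intro exI[of _ \<delta>] conjI \<delta> allI impI)
    fix S :: "(real \<times> real) set"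
    assume S: "finite S" "\<forall>(u, v)\<in>S. c \<le> u \<and> u \<le> v \<and> v \<le> d"
      "pairwise (\<lambda>p q. disjnt {fst p<..<snd p} {fst q<..<snd q}) S" "(\<Sum>(u, v)\<in>S. v - u) < \<delta>"
    have "\<forall>(u, v)\<in>S. a \<le> u \<and> u \<le> v \<and> v \<le> b" using S(2) assms(2,3) by force
    from le[OF S(1) this S(3,4)] show "(\<Sum>(u, v)\<in>S. norm (f v - f u)) < e" .
  qed
qed

lemma abs_continuous_imp_continuous_on:
  assumes "abs_continuous_on_interval a b f"
  shows "continuous_on {a..b} f"
  unfolding continuous_on_iff
proof (intro ballI allI impI)
  fix s and e :: real assume s: "s \<in> {a..b}" and e: "e > 0"
  obtain \<delta> where \<delta>: "\<delta> > 0" and le: "\<And>S :: (real \<times> real) set.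
        finite S \<Longrightarrow> (\<forall>(u, v) \<in> S. a \<le> u \<and> u \<le> v \<and> v \<le> b) \<Longrightarrow>
        pairwise (\<lambda>p q. disjnt {fst p<..<snd p} {fst q<..<snd q}) S \<Longrightarrow>
        (\<Sum>(u, v) \<in> S. v - u) < \<delta> \<Longrightarrow> (\<Sum>(u, v) \<in> S. norm (f v - f u)) < e"
    using abs_continuousE[OF assms e] by blast
  have "dist (f t) (f s) < e" if t: "t \<in> {a..b}" "dist t s < \<delta>" for t
    using le[of "{(s, t)}"] le[of "{(t, s)}"] s t
    by (cases "s \<le> t") (auto simp: dist_norm norm_minus_commute)
  with \<delta> show "\<exists>d>0. \<forall>t\<in>{a..b}. dist t s < d \<longrightarrow> dist (f t) (f s) < e" by blast
qed

lemma lipschitz_imp_abs_continuous: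
  assumes L: "L \<ge> 0" and lip: "\<And>u v. a \<le> u \<Longrightarrow> u \<le> v \<Longrightarrow> v \<le> b \<Longrightarrow> norm (f v - f u) \<le> L * (v - u)"
  shows "abs_continuous_on_interval a b f"
  unfolding abs_continuous_on_interval_def
proof (intro allI impI)
  fix e :: real assume e: "e > 0"
  show "\<exists>\<delta>>0. \<forall>S. finite S \<longrightarrow> (\<forall>(u, v)\<in>S. a \<le> u \<and> u \<le> v \<and> v \<le> b) \<longrightarrow>
      pairwise (\<lambda>p q. disjnt {fst p<..<snd p} {fst q<..<snd q}) S \<longrightarrow>
      (\<Sum>(u, v)\<in>S. v - u) < \<delta> \<longrightarrow> (\<Sum>(u, v)\<in>S. norm (f v - f u)) < e"
  \<comment> \<open>The added 1 covers \<open>L = 0\<close> and makes the final inequality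
    strict.\<close>
  proof (intro exI[of _ "e / (L + 1)"] conjI allI impI)
    show "0 < e / (L + 1)" using e L by simp
    fix S :: "(real \<times> real) set"
    assume S: "\<forall>(u, v)\<in>S. a \<le> u \<and> u \<le> v \<and> v \<le> b" "(\<Sum>(u, v)\<in>S. v - u) < e / (L + 1)"
    have "(\<Sum>(u, v)\<in>S. norm (f v - f u)) \<le> (\<Sum>(u, v)\<in>S. L * (v - u))"
      using S(1) lip by (intro sum_mono) auto
    also have "\<dots> = L * (\<Sum>(u, v)\<in>S. v - u)"
      by (simp add: sum_distrib_left case_prod_beta)
    also have "\<dots> \<le> L * (e / (L + 1))" using S(2) L by (intro mult_left_mono) auto
    also have "\<dots> < e" using e L by (simp add: field_simps)
    finally show "(\<Sum>(u, v)\<in>S. norm (f v - f u)) < e" .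
  qed
qed

text \<open>Meant for functions known only off a null set, such as \<open>interval_deriv\<close>,
  which is arbitrary where no derivative exists. Completeness of the measure transfers measurability
  from \<open>h\<close> to \<open>f\<close>.\<close>

lemma L2_of_bounded:
  fixes f h :: "real \<Rightarrow> 'a::euclidean_space"
  assumes h: "h \<in> borel_measurable (lebesgue_on {0..T})" and B: "\<And>t. t \<in> {0..T} \<Longrightarrow> norm (h t) \<le> B"
    and N: "negligible N" and eq: "\<And>t. t \<in> {0..T} - N \<Longrightarrow> f t = h t"
  shows "in_L2 T f" and "L2_norm T f = sqrt (integral {0..T} (\<lambda>t. (norm (h t))\<^sup>2))"
proof -
  have S: "{0..T} \<in> sets lebesgue" by simp
  have "(\<lambda>t. if t \<in> {0..T} then h t else 0) \<in> borel_measurable lebesgue"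
    using h by (simp only: borel_measurable_if[OF S])
  moreover have "AE t in lebesgue. (if t \<in> {0..T} then h t else 0) = (if t \<in> {0..T} then f t else 0)"
    unfolding eventually_ae_filter_negligible
  proof (intro exI[of _ N] conjI N subsetI, rule ccontr)
    fix t assume "t \<in> {t. (if t \<in> {0..T} then h t else 0) \<noteq> (if t \<in> {0..T} then f t else 0)}" "t \<notin> N"
    then show False using eq[of t] by (auto split: if_splits)
  qed
  ultimately have "(\<lambda>t. if t \<in> {0..T} then f t else 0) \<in> borel_measurable lebesgue"
    by (rule borel_measurable_AE)
  then have f: "f \<in> borel_measurable (lebesgue_on {0..T})" by (simp only: borel_measurable_if[OF S])
  have h2: "(\<lambda>t. (norm (h t))\<^sup>2) absolutely_integrable_on {0..T}"
  proof (rule bounded_measurable_absolutely_integrable)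
    show "(\<lambda>t. (norm (h t))\<^sup>2) \<in> borel_measurable (lebesgue_on {0..T})" using h by measurable
    show "norm ((norm (h t))\<^sup>2) \<le> B\<^sup>2" if "t \<in> {0..T}" for t
      using B[OF that] by (simp add: power_mono)
  qed
  have f2: "(\<lambda>t. (norm (f t))\<^sup>2) absolutely_integrable_on {0..T}"
    by (rule absolutely_integrable_spike[OF h2 N]) (simp add: eq)
  then have int: "integrable (lebesgue_on {0..T}) (\<lambda>t. (norm (f t))\<^sup>2)"
    by (simp add: absolutely_integrable_on_def integrable_restrict_space set_integrable_def)
  with f show "in_L2 T f" by (simp add: in_L2_def)
  have "(LINT t|lebesgue_on {0..T}. (norm (f t))\<^sup>2) = integral {0..T} (\<lambda>t. (norm (f t))\<^sup>2)"
    by (rule lebesgue_integral_eq_integral[OF int S])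
  also have "\<dots> = integral {0..T} (\<lambda>t. (norm (h t))\<^sup>2)"
    by (rule integral_spike[OF N]) (simp add: eq)
  finally show "L2_norm T f = sqrt (integral {0..T} (\<lambda>t. (norm (h t))\<^sup>2))" by (simp add: L2_norm_def)
qed

text \<open>Pointwise, the square of \<open>norm (h t)\<close> is at most
  \<open>B * norm (h t)\<close>.\<close>

lemma L2_norm_le_L1:
  fixes f h :: "real \<Rightarrow> 'a::euclidean_space"
  assumes h: "h \<in> borel_measurable (lebesgue_on {0..T})" and B: "\<And>t. t \<in> {0..T} \<Longrightarrow> norm (h t) \<le> B"
    and N: "negligible N" and eq: "\<And>t. t \<in> {0..T} - N \<Longrightarrow> f t = h t"
  shows "L2_norm T f \<le> sqrt (B * integral {0..T} (\<lambda>t. norm (h t)))"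
proof -
  have n: "(\<lambda>t. norm (h t)) integrable_on {0..T}"
    using bounded_measurable_absolutely_integrable[OF h B] by (simp add: absolutely_integrable_on_def)
  have "(\<lambda>t. (norm (h t))\<^sup>2) absolutely_integrable_on {0..T}"
  proof (rule bounded_measurable_absolutely_integrable)
    show "(\<lambda>t. (norm (h t))\<^sup>2) \<in> borel_measurable (lebesgue_on {0..T})" using h by measurable
    show "norm ((norm (h t))\<^sup>2) \<le> B\<^sup>2" if "t \<in> {0..T}" for t
      using B[OF that] by (simp add: power_mono)
  qed
  then have "integral {0..T} (\<lambda>t. (norm (h t))\<^sup>2) \<le> integral {0..T} (\<lambda>t. B * norm (h t))"
    using B by (intro integral_le integrable_on_mult_right n)
      (auto simp: power2_eq_square intro: mult_right_mono dest: set_lebesgue_integral_eq_integral(1))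
  also have "\<dots> = B * integral {0..T} (\<lambda>t. norm (h t))" by simp
  finally show ?thesis
    using L2_of_bounded(2)[OF h B N eq] by simp
qed

text \<open>Boundedness makes the real suprema genuine upper bounds of the distances, and closedness
  makes each distance attained.\<close>

lemma pompeiu_hausdorff_near:
  fixes A B :: "'a::euclidean_space set"
  assumes A: "A \<subseteq> cball 0 m" "closed A" "A \<noteq> {}" and B: "B \<subseteq> cball 0 m" "closed B" "B \<noteq> {}"
    and d: "pompeiu_hausdorff A B < e"
  shows "a \<in> A \<Longrightarrow> \<exists>b\<in>B. norm (a - b) \<le> e" and "b \<in> B \<Longrightarrow> \<exists>a\<in>A. norm (b - a) \<le> e"
proof -
  have near: "\<exists>y\<in>Y. norm (x - y) \<le> e"
    if X: "X \<subseteq> cball 0 m" and Y: "Y \<subseteq> cball 0 m" "closed Y" "Y \<noteq> {}"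
      and le: "(SUP x\<in>X. infdist x Y) < e" and x: "x \<in> X" for X Y :: "'a set" and x
  proof -
    obtain y0 where y0: "y0 \<in> Y" using Y(3) by blast
    have "infdist x' Y \<le> m + norm y0" if "x' \<in> X" for x'
      using infdist_le[OF y0, of x'] norm_triangle_ineq4[of x' y0] X that by (force simp: dist_norm)
    then have "bdd_above ((\<lambda>x. infdist x Y) ` X)" by (intro bdd_aboveI2)
    from cSUP_upper[OF x this] le have "infdist x Y \<le> e" by simp
    then show ?thesis
      using infdist_attains_inf[OF Y(2,3), of x] by (metis dist_norm)
  qed
  show "a \<in> A \<Longrightarrow> \<exists>b\<in>B. norm (a - b) \<le> e" and "b \<in> B \<Longrightarrow> \<exists>a\<in>A. norm (b - a) \<le> e"
    using near[OF A(1) B, of a] near[OF B(1) A, of b] d by (auto simp: pompeiu_hausdorff_def)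
qed

text \<open>Mean value inequality on the ball, which is convex.\<close>

lemma jacobian_bound_imp_lipschitz:
  fixes f :: "real ^ 'n \<Rightarrow> real ^ 'm"
  assumes d: "\<And>x. f differentiable (at x)"
    and b: "\<And>x. x \<in> cball 0 \<eta> \<Longrightarrow> onorm ((*v) (jacobian f (at x))) \<le> \<alpha>"
    and x: "x \<in> cball 0 \<eta>" and y: "y \<in> cball 0 \<eta>"
  shows "norm (f x - f y) \<le> \<alpha> * norm (x - y)"
proof (rule differentiable_bound[of "cball 0 \<eta>" f "\<lambda>x. (*v) (jacobian f (at x))"])
  show "(f has_derivative (*v) (jacobian f (at x))) (at x within cball 0 \<eta>)" for x
    using d[of x] jacobian_works[of f "at x"] by (metis has_derivative_at_withinI)
qed (use b x y in auto)

lemma scheme_data_of_assumptions: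
  fixes F :: "real \<Rightarrow> real ^ 'n \<Rightarrow> (real ^ 'n) set"
  assumes T: "T > 0" and F: "assumption_F T F" and g: "assumption_g T g"
  obtains m l \<beta> where "scheme_data T m l \<beta> F g"
proof -
  obtain m l where m: "m \<ge> 0" "\<forall>t\<in>{0..T}. \<forall>x. F t x \<subseteq> cball 0 m"
    and l: "l \<ge> 0" "\<forall>t\<in>{0..T}. \<forall>x1 x2. F t x1 \<subseteq> F t x2 + cball 0 (l * norm (x1 - x2))"
    using F unfolding assumption_F_def by blast
  obtain \<beta> where \<beta>: "\<beta> \<ge> 0" "\<forall>t\<in>{0..T}. \<forall>s\<in>{0..t}. \<forall>x. norm (g t s x) \<le> \<beta> * (1 + norm x)"
    using g unfolding assumption_g_def by blast
  have diff: "g t s differentiable (at x)" if "t \<in> {0..T}" "s \<in> {0..T}" for t s x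
    using g that unfolding assumption_g_def by blast
  have "scheme_data T m l \<beta> F g"
  proof
    show "\<exists>y'\<in>F t x2. norm (y - y') \<le> l * norm (x1 - x2)" if "t \<in> {0..T}" "y \<in> F t x1" for t y x1 x2
    proof -
      have "y \<in> F t x2 + cball 0 (l * norm (x1 - x2))" using l(2) that by blast
      then obtain y' z where "y' \<in> F t x2" "norm z \<le> l * norm (x1 - x2)" "y = y' + z"
        by (auto simp: set_plus_def)
      then show ?thesis by (intro bexI[of _ y']) auto
    qed
    show "continuous_on UNIV (g t s)" if "t \<in> {0..T}" "s \<in> {0..T}" for t s
      using diff[OF that] by (simp add: continuous_at_imp_continuous_on differentiable_imp_continuous_within)
    show "\<exists>\<alpha>\<ge>0. \<forall>t\<in>{0..T}. \<forall>s\<in>{0..t}. \<forall>x\<in>cball 0 \<eta>. \<forall>y\<in>cball 0 \<eta>. norm (g t s x - g t s y) \<le> \<alpha> * norm (x - y)"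
      if \<eta>: "\<eta> > 0" for \<eta>
    proof -
      obtain \<alpha> where \<alpha>: "\<alpha> \<ge> 0" "\<forall>t\<in>{0..T}. \<forall>s\<in>{0..t}. \<forall>x\<in>cball 0 \<eta>. onorm ((*v) (jacobian (g t s) (at x))) \<le> \<alpha>"
        using g \<eta> unfolding assumption_g_def by blast
      have "norm (g t s x - g t s y) \<le> \<alpha> * norm (x - y)"
        if "t \<in> {0..T}" "s \<in> {0..t}" "x \<in> cball 0 \<eta>" "y \<in> cball 0 \<eta>" for t s x y
        using that \<alpha>(2) by (intro jacobian_bound_imp_lipschitz[OF diff]) auto
      with \<alpha>(1) show ?thesis by blast
    qed
    show "norm y \<le> m" if "t \<in> {0..T}" "y \<in> F t x" for t y x
      using m(2) that by (metis mem_cball_0 subsetD)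
    show "(\<lambda>(t, s). g t s x) \<in> borel_measurable (lebesgue_on ({0..T} \<times> {0..T}))" for x
      using g unfolding assumption_g_def by blast
    show "norm (g t s x) \<le> \<beta> * (1 + norm x)" if "t \<in> {0..T}" "s \<in> {0..t}" for t s x
      using \<beta>(2) that by blast
    show "F t x \<noteq> {}" "closed (F t x)" if "t \<in> {0..T}" for t x
      using F that unfolding assumption_F_def by blast+
  qed (use T m(1) l(1) \<beta>(1) in auto)
  then show thesis by (rule that)
qed

lemma interval_deriv_eq:
  assumes "T > 0" "t \<in> {0..T}" "(f has_vector_derivative d) (at t within {0..T})"
  shows "interval_deriv T f t = d"
  unfolding interval_deriv_def
  using vector_derivative_within_cbox[of 0 T t f d] assms by simp

section \<open>Piecewise linear interpolation of node values\<close>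

definition interpolant :: "real \<Rightarrow> nat \<Rightarrow> (nat \<Rightarrow> 'a::real_normed_vector) \<Rightarrow> (nat \<Rightarrow> 'a) \<Rightarrow> real \<Rightarrow> 'a" where
  "interpolant T k \<xi> v t =
     \<xi> (cell_index T k t) + (t - grid T k (cell_index T k t)) *\<^sub>R v (cell_index T k t)"

context
  fixes T :: real and k :: nat and \<xi> v :: "nat \<Rightarrow> 'a::real_normed_vector"
  assumes T: "T > 0" and k: "k \<ge> 1"
    and step: "\<And>j. j < k \<Longrightarrow> \<xi> (Suc j) = \<xi> j + (T / real k) *\<^sub>R v j"
begin

lemma interpolant_grid:
  assumes "j \<le> k"
  shows "interpolant T k \<xi> v (grid T k j) = \<xi> j"
proof (cases j)
  case 0
  then show ?thesis by (simp add: interpolant_def)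
next
  case (Suc i)
  have "cell_index T k (grid T k (Suc i)) = i"
    using T k by (intro cell_index_eq[OF T k]) (auto simp: grid_Suc)
  then show ?thesis
    using Suc assms step[of i] by (simp add: interpolant_def) (simp add: grid_Suc)
qed

text \<open>Valid on the closed cell. For \<open>j > 0\<close> the definition evaluates the left
  node through the previous cell, and the recursion \<open>step\<close> makes the two values
  agree.\<close>

lemma interpolant_cell:
  assumes j: "j < k" and t: "t \<in> {grid T k j..grid T k (Suc j)}"
  shows "interpolant T k \<xi> v t = \<xi> j + (t - grid T k j) *\<^sub>R v j"
proof (cases "t = grid T k j")
  case True
  then show ?thesis using interpolant_grid[of j] j by simp
next
  case False
  then show ?thesis using t by (simp add: interpolant_def cell_index_eq[OF T k, of j])
qed

text \<open>On one cell the function is affine with slope \<open>v j\<close>; an interval meeting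
  several cells is cut at the last node, by induction on the number of cells.\<close>

lemma interpolant_lipschitz:
  assumes V: "\<And>j. j < k \<Longrightarrow> norm (v j) \<le> V" and ab: "0 \<le> a" "a \<le> b" "b \<le> T"
  shows "norm (interpolant T k \<xi> v b - interpolant T k \<xi> v a) \<le> V * (b - a)"
proof -
  let ?x = "interpolant T k \<xi> v"
  have cell: "norm (?x b - ?x a) \<le> V * (b - a)"
    if "j < k" "grid T k j \<le> a" "a \<le> b" "b \<le> grid T k (Suc j)" for a b j
  proof -
    have "?x b - ?x a = (b - a) *\<^sub>R v j"
      using that by (simp add: interpolant_cell[OF that(1), of a] interpolant_cell[OF that(1), of b] algebra_simps)
    then have "norm (?x b - ?x a) = (b - a) * norm (v j)" using that by simp
    also have "\<dots> \<le> (b - a) * V" using V[OF that(1)] that by (intro mult_left_mono) auto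
    finally show ?thesis by (simp add: mult.commute)
  qed
  have "norm (?x b - ?x a) \<le> V * (b - a)" if "0 \<le> a" "a \<le> b" "b \<le> grid T k n" "n \<le> k" for a b n
    using that
  proof (induction n arbitrary: a b)
    case 0
    then have "a = b" by simp
    then show ?case by simp
  next
    case (Suc n)
    have n: "n < k" using Suc.prems by simp
    consider "b \<le> grid T k n" | "grid T k n \<le> a" | "a \<le> grid T k n" "grid T k n \<le> b" by linarith
    then show ?case
    proof cases
      case 1
      then show ?thesis using Suc by simp
    next
      case 2
      then show ?thesis using Suc.prems n by (intro cell[of n]) auto
    next
      case 3
      have "norm (?x (grid T k n) - ?x a) \<le> V * (grid T k n - a)"
        using Suc.prems 3 by (intro Suc.IH) auto
      moreover have "norm (?x b - ?x (grid T k n)) \<le> V * (b - grid T k n)"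
        using Suc.prems 3 n by (intro cell[of n]) auto
      moreover have "norm (?x b - ?x a) \<le> norm (?x b - ?x (grid T k n)) + norm (?x (grid T k n) - ?x a)"
        using norm_triangle_ineq[of "?x b - ?x (grid T k n)" "?x (grid T k n) - ?x a"] by simp
      ultimately show ?thesis by (simp add: algebra_simps)
    qed
  qed
  from this[OF ab(1,2), of k] show ?thesis using ab(3) k by simp
qed

lemma interpolant_derivative:
  assumes t: "t \<in> {0..T} - grid T k ` {..k}"
  shows "(interpolant T k \<xi> v has_vector_derivative v (cell_index T k t)) (at t within S)"
proof -
  let ?j = "cell_index T k t"
  have j: "?j < k" and tj: "t \<in> {grid T k ?j..grid T k (Suc ?j)}"
    using cell_index_less[OF T k, of t] t by auto
  have "t \<noteq> grid T k ?j" "t \<noteq> grid T k (Suc ?j)"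
    using t j by (auto simp: image_iff Suc_le_eq less_imp_le)
  with tj have op: "t \<in> {grid T k ?j<..<grid T k (Suc ?j)}" by auto
  have "((\<lambda>s. \<xi> ?j + (s - grid T k ?j) *\<^sub>R v ?j) has_vector_derivative v ?j) (at t)"
    by (auto intro!: derivative_eq_intros)
  then have "(interpolant T k \<xi> v has_vector_derivative v ?j) (at t)"
    by (rule has_vector_derivative_transform_within_open[OF _ _ op])
       (auto simp: interpolant_cell[OF j])
  then show ?thesis by (rule has_vector_derivative_at_within)
qed

end

text \<open>A mesh is determined only at indices up to \<open>k\<close>, so it need not equal
  \<open>grid T k\<close> as a function; the scheme reads no further indices.\<close>

lemma is_discrete_approximation_mesh_cong:
  assumes eq: "\<And>j. j \<le> k \<Longrightarrow> \<tau> j = \<sigma> j" and d: "is_discrete_approximation F g x0 k \<sigma> x y v w"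
  shows "is_discrete_approximation F g x0 k \<tau> x y v w"
proof -
  have e1: "(\<Sum>i<j. LINT s:{\<tau> i..\<tau> (Suc i)}|lebesgue. g t s (x (\<tau> i))) =
      (\<Sum>i<j. LINT s:{\<sigma> i..\<sigma> (Suc i)}|lebesgue. g t s (x (\<sigma> i)))" if "j < k" for j t
    using that eq by (intro sum.cong) auto
  have e2: "\<tau> j = \<sigma> j" "\<tau> (Suc j) = \<sigma> (Suc j)" if "j < k" for j
    using that eq by auto
  have d1: "x 0 = x0" "y 0 = 0"
    and d2: "\<And>j t. j < k \<Longrightarrow> t \<in> {\<sigma> j<..\<sigma> (Suc j)} \<Longrightarrow> x t = x (\<sigma> j) + (t - \<sigma> j) *\<^sub>R v j \<and> y t = w j"
    and d3: "\<And>j. j < k \<Longrightarrow> \<exists>u\<in>F (\<sigma> j) (x (\<sigma> j)). v j = u + w j"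
    and d4: "\<And>j. j < k \<Longrightarrow> w j = (1 / (\<sigma> (Suc j) - \<sigma> j)) *\<^sub>R
        (LINT t:{\<sigma> j..\<sigma> (Suc j)}|lebesgue.
           (\<Sum>i<j. LINT s:{\<sigma> i..\<sigma> (Suc i)}|lebesgue. g t s (x (\<sigma> i))) +
           (LINT s:{\<sigma> j..t}|lebesgue. g t s (x (\<sigma> j))))"
    using d unfolding is_discrete_approximation_def by blast+
  show ?thesis
    unfolding is_discrete_approximation_def
  proof (intro conjI d1 allI impI ballI)
    fix j assume j: "j < k"
    show "x t = x (\<tau> j) + (t - \<tau> j) *\<^sub>R v j" "y t = w j" if "t \<in> {\<tau> j<..\<tau> (Suc j)}" for t
      using d2[OF j] that e2[OF j] by simp_all
    show "\<exists>u\<in>F (\<tau> j) (x (\<tau> j)). v j = u + w j"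
      using d3[OF j] e2[OF j] by simp
    show "w j = (1 / (\<tau> (Suc j) - \<tau> j)) *\<^sub>R
        (LINT t:{\<tau> j..\<tau> (Suc j)}|lebesgue.
           (\<Sum>i<j. LINT s:{\<tau> i..\<tau> (Suc i)}|lebesgue. g t s (x (\<tau> i))) +
           (LINT s:{\<tau> j..t}|lebesgue. g t s (x (\<tau> j))))"
      using d4[OF j] by (simp only: e1[OF j] e2[OF j])
  qed
qed

section \<open>Convergence in W12 and L2\<close>

context scheme_solution
begin

lemma scheme_velocity_bound:
  assumes k: "k \<ge> 1" and sch: "is_scheme k \<xi> u w" and j: "j < k"
  shows "norm (w j) \<le> \<beta> * (1 + scheme_bound) * T"
    and "norm (u j + w j) \<le> m + \<beta> * (1 + scheme_bound) * T"
proof -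
  show w: "norm (w j) \<le> \<beta> * (1 + scheme_bound) * T"
  proof (rule scheme_w_bound[OF k sch j])
    show "norm (\<xi> i) \<le> scheme_bound" if "i \<le> j" for i
      using scheme_bounded[OF k sch, of i] that j by simp
  qed
  have "norm (u j) \<le> m"
    using sch j by (intro F_bound[OF grid_in[OF j]]) (auto simp: is_scheme_def)
  with w show "norm (u j + w j) \<le> m + \<beta> * (1 + scheme_bound) * T"
    using norm_triangle_ineq[of "u j" "w j"] by simp
qed

text \<open>The value of \<open>y\<close> at time 0 is prescribed separately because
  \<open>cell_index\<close> would assign \<open>w 0\<close> to it.\<close>

lemma is_discrete_approximation_interpolant:
  assumes k: "k \<ge> 1" and sch: "is_scheme k \<xi> u w"
  shows "is_discrete_approximation F g x0 k (grid T k) (interpolant T k \<xi> (\<lambda>j. u j + w j))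
     (\<lambda>t. if t = 0 then 0 else w (cell_index T k t)) (\<lambda>j. u j + w j) w"
proof -
  let ?x = "interpolant T k \<xi> (\<lambda>j. u j + w j)"
  have step: "\<xi> (Suc j) = \<xi> j + (T / real k) *\<^sub>R (u j + w j)" if "j < k" for j
    using sch that unfolding is_scheme_def by blast
  note grd = interpolant_grid[where v="\<lambda>j. u j + w j" and \<xi>=\<xi>, OF T_pos k step]
  note cell = interpolant_cell[where v="\<lambda>j. u j + w j" and \<xi>=\<xi>, OF T_pos k step]
  have "?x 0 = x0"
    using grd[of 0] sch by (simp add: is_scheme_def)
  moreover have "?x t = ?x (grid T k j) + (t - grid T k j) *\<^sub>R (u j + w j) \<and>
      (if t = 0 then 0 else w (cell_index T k t)) = w j"
    if j: "j < k" and t: "t \<in> {grid T k j<..grid T k (Suc j)}" for j t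
  proof -
    have "t \<noteq> 0" using t grid_nonneg[OF T_pos, of k j] by auto
    then show ?thesis
      using cell[OF _ j, of t] grd[OF _ less_imp_le[OF j]] t cell_index_eq[OF T_pos k, of j t] by simp
  qed
  moreover have "\<exists>f\<in>F (grid T k j) (?x (grid T k j)). u j + w j = f + w j" if "j < k" for j
    using sch that grd[of j] by (auto simp: is_scheme_def)
  moreover have "w j = (1 / (grid T k (Suc j) - grid T k j)) *\<^sub>R
     (LINT t:{grid T k j..grid T k (Suc j)}|lebesgue.
        (\<Sum>i<j. LINT s:{grid T k i..grid T k (Suc i)}|lebesgue. g t s (?x (grid T k i))) +
        (LINT s:{grid T k j..t}|lebesgue. g t s (?x (grid T k j))))" if j: "j < k" for j
  proof -
    have "w j = discrete_memory T k g \<xi> j" using sch j by (simp add: is_scheme_def)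
    moreover have "(\<Sum>i<j. LINT s:{grid T k i..grid T k (Suc i)}|lebesgue. g t s (?x (grid T k i))) =
        (\<Sum>i<j. LINT s:{grid T k i..grid T k (Suc i)}|lebesgue. g t s (\<xi> i))" for t
      using j grd by (intro sum.cong) auto
    ultimately show ?thesis
      using grd[of j] j by (simp add: discrete_memory_def)
  qed
  ultimately show ?thesis
    unfolding is_discrete_approximation_def by simp
qed

text \<open>The derivative of \<open>xbar\<close> returns as a hypothesis because
  \<open>W12_norm\<close> is built from \<open>interval_deriv\<close>, whereas the error estimates
  used increments only.\<close>

lemma approximation_converges:
  assumes ac: "abs_continuous_on_interval 0 T xbar"
    and der: "\<And>t. t \<in> {0..T} - N \<Longrightarrow> (xbar has_vector_derivative (ubar t + ybar t)) (at t within {0..T})"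
  obtains x y v w where
    "\<And>k. k \<ge> 1 \<Longrightarrow> is_discrete_approximation F g x0 k (grid T k) (x k) (y k) (v k) (w k)"
    "W12_convergence T x xbar" "L2_convergence T y ybar"
proof -
  obtain \<xi> u w and \<epsilon> :: "nat \<Rightarrow> real" where sch: "\<And>k. k \<ge> 1 \<Longrightarrow> is_scheme k (\<xi> k) (u k) (w k)"
    and \<epsilon>: "\<epsilon> \<longlonglongrightarrow> 0"
    and nodes: "\<And>k j. k \<ge> 1 \<Longrightarrow> j \<le> k \<Longrightarrow> norm (\<xi> k j - xbar (grid T k j)) \<le> \<epsilon> k"
    and uL1: "\<And>k. k \<ge> 1 \<Longrightarrow> integral {0..T} (\<lambda>t. norm (u k (cell_index T k t) - ubar t)) \<le> \<epsilon> k"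
    and wL1: "\<And>k. k \<ge> 1 \<Longrightarrow> integral {0..T} (\<lambda>t. norm (w k (cell_index T k t) - ybar t)) \<le> \<epsilon> k"
    using scheme_converges by blast
  define v where "v k j = u k j + w k j" for k j
  define x where "x k = interpolant T k (\<xi> k) (v k)" for k
  define y where "y k t = (if t = 0 then 0 else w k (cell_index T k t))" for k t
  define W where "W = \<beta> * (1 + scheme_bound) * T"
  define Y where "Y = \<beta> * (1 + R) * T"
  define V where "V = m + W"
  let ?D = "\<lambda>t. ubar t + ybar t"
  let ?G = "\<lambda>k. grid T k ` {..k}"
  have approx: "is_discrete_approximation F g x0 k (grid T k) (x k) (y k) (v k) (w k)" if "k \<ge> 1" for k
    using is_discrete_approximation_interpolant[OF that sch[OF that]]
    by (simp add: x_def y_def[abs_def] v_def[abs_def])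
  have step: "\<xi> k (Suc j) = \<xi> k j + (T / real k) *\<^sub>R v k j" if "k \<ge> 1" "j < k" for k j
    using sch[OF that(1)] that(2) unfolding is_scheme_def v_def by blast
  have wW: "norm (w k (cell_index T k t)) \<le> W" and vV: "norm (v k (cell_index T k t)) \<le> V"
    if "k \<ge> 1" "t \<in> {0..T}" for k t
    using scheme_velocity_bound[OF that(1) sch[OF that(1)] cell_index_less(1)[OF T_pos that]]
    by (simp_all add: V_def W_def v_def)
  have V0: "0 \<le> V" using order_trans[OF norm_ge_zero vV[of 1 0]] T_pos by simp
  have lip: "norm (x k b - x k a) \<le> V * (b - a)" if "k \<ge> 1" "0 \<le> a" "a \<le> b" "b \<le> T" for k a b
  proof -
    have "norm (v k j) \<le> V" if "j < k" for j
      using scheme_velocity_bound(2)[OF \<open>k \<ge> 1\<close> sch[OF \<open>k \<ge> 1\<close>] that] by (simp add: V_def W_def v_def)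
    then show ?thesis
      unfolding x_def using that
      by (intro interpolant_lipschitz[where \<xi> = "\<xi> k" and v = "v k", OF T_pos that(1) step[OF that(1)]]) auto
  qed
  have xac: "abs_continuous_on_interval 0 T (x k)" if "k \<ge> 1" for k
    using lipschitz_imp_abs_continuous[OF V0 lip[OF that]] .
  have xder: "(x k has_vector_derivative v k (cell_index T k t)) (at t within {0..T})"
    if "k \<ge> 1" "t \<in> {0..T} - ?G k" for k t
    unfolding x_def
    by (rule interpolant_derivative[where \<xi> = "\<xi> k" and v = "v k", OF T_pos that(1) step[OF that(1)] that(2)])
  have stepm: "(\<lambda>t. a (cell_index T k t)) \<in> borel_measurable (lebesgue_on {0..T})" for a :: "nat \<Rightarrow> real ^ 'n" and k
    by (intro borel_measurable_lebesgue_on) measurable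
  have Dm: "?D \<in> borel_measurable (lebesgue_on {0..T})"
    using ubar_measurable ybar_regular(1) by measurable
  have Db: "norm (?D t) \<le> speed" if "t \<in> {0..T}" for t
    using norm_triangle_ineq[of "ubar t" "ybar t"] ubar_bound[OF that] ybar_bound[OF that] by (simp add: speed_def)
  \<comment> \<open>The nodes are where the interpolant may have a kink.\<close>
  have negG: "negligible (?G k)" for k by (intro negligible_finite) auto
  have "interval_deriv T xbar t = ?D t" if "t \<in> {0..T} - N" for t
    using interval_deriv_eq[OF T_pos _ der[OF that]] that by simp
  from L2_of_bounded(1)[OF Dm Db negligible_N this]
  have W12xbar: "in_W12 T xbar" using ac by (simp add: in_W12_def)
  have W12x: "in_W12 T (x k)" if k: "k \<ge> 1" for k
  proof -
    have "interval_deriv T (x k) t = v k (cell_index T k t)" if "t \<in> {0..T} - ?G k" for t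
      using interval_deriv_eq[OF T_pos _ xder[OF k that]] that by simp
    from L2_of_bounded(1)[where h = "\<lambda>t. v k (cell_index T k t)", OF stepm vV[OF k] negG[of k] this] show ?thesis
      using xac[OF k] by (simp add: in_W12_def)
  qed
  \<comment> \<open>Node error plus the motion of \<open>x k\<close> and of \<open>xbar\<close>
    within one cell.\<close>
  define \<delta> where "\<delta> k = \<epsilon> k + (V + speed) * (T / real k)" for k
  have pos: "norm (x k t - xbar t) \<le> \<delta> k" if k: "k \<ge> 1" and t: "t \<in> {0..T}" for k t
  proof -
    let ?j = "cell_index T k t"
    have j: "?j < k" and tj: "t \<in> {grid T k ?j..grid T k (Suc ?j)}" using cell_index_less[OF T_pos k t] by auto
    have d: "0 \<le> t - grid T k ?j" "t - grid T k ?j \<le> T / real k" using tj by (auto simp: grid_Suc)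
    have xg: "x k (grid T k ?j) = \<xi> k ?j"
      unfolding x_def using j
      by (intro interpolant_grid[where \<xi> = "\<xi> k" and v = "v k", OF T_pos k step[OF k]]) auto
    have "norm (x k t - x k (grid T k ?j)) \<le> V * (t - grid T k ?j)"
      using lip[OF k, of "grid T k ?j" t] grid_nonneg[OF T_pos, of k ?j] tj t by simp
    also have "\<dots> \<le> V * (T / real k)" using d(2) V0 by (rule mult_left_mono)
    finally have 1: "norm (x k t - \<xi> k ?j) \<le> V * (T / real k)" by (simp only: xg)
    have "norm (xbar t - xbar (grid T k ?j)) \<le> speed * \<bar>t - grid T k ?j\<bar>"
      by (rule xbar_lipschitz[OF t grid_in[OF j]])
    also have "\<dots> \<le> speed * (T / real k)" using d speed_nonneg by (intro mult_left_mono) auto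
    finally have 2: "norm (xbar t - xbar (grid T k ?j)) \<le> speed * (T / real k)" .
    have "norm (x k t - xbar t) \<le> norm (x k t - \<xi> k ?j) + norm ((\<xi> k ?j - xbar (grid T k ?j)) - (xbar t - xbar (grid T k ?j)))"
      using norm_triangle_ineq[of "x k t - \<xi> k ?j" "(\<xi> k ?j - xbar (grid T k ?j)) - (xbar t - xbar (grid T k ?j))"] by simp
    also have "\<dots> \<le> norm (x k t - \<xi> k ?j) + (norm (\<xi> k ?j - xbar (grid T k ?j)) + norm (xbar t - xbar (grid T k ?j)))"
      by (intro add_left_mono norm_triangle_ineq4)
    finally show ?thesis
      using 1 2 nodes[OF k less_imp_le[OF j]] unfolding \<delta>_def distrib_right by linarith
  qed
  have \<delta>0: "0 \<le> \<delta> k" if "k \<ge> 1" for k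
    using order_trans[OF norm_ge_zero pos[OF that, of 0]] T_pos by simp
  have posL2: "L2_norm T (\<lambda>t. x k t - xbar t) \<le> sqrt (\<delta> k * (\<delta> k * T))" if k: "k \<ge> 1" for k
  proof -
    have "continuous_on {0..T} (\<lambda>t. x k t - xbar t)"
      using abs_continuous_imp_continuous_on[OF xac[OF k]] xbar_continuous by (intro continuous_on_diff)
    then have ms: "(\<lambda>t. x k t - xbar t) \<in> borel_measurable (lebesgue_on {0..T})"
      by (intro continuous_imp_measurable_on_sets_lebesgue) auto
    have "(\<lambda>t. norm (x k t - xbar t)) integrable_on {0..T}"
      using bounded_measurable_absolutely_integrable[OF ms pos[OF k]] by (simp add: absolutely_integrable_on_def)
    then have "integral {0..T} (\<lambda>t. norm (x k t - xbar t)) \<le> integral {0..T} (\<lambda>t. \<delta> k)"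
      using pos[OF k] by (intro integral_le) auto
    then have "integral {0..T} (\<lambda>t. norm (x k t - xbar t)) \<le> \<delta> k * T" using T_pos by (simp add: mult.commute)
    then have "\<delta> k * integral {0..T} (\<lambda>t. norm (x k t - xbar t)) \<le> \<delta> k * (\<delta> k * T)"
      using \<delta>0[OF k] by (rule mult_left_mono)
    then show ?thesis
      using L2_norm_le_L1[OF ms pos[OF k] negligible_empty refl] by (meson order_trans real_sqrt_le_mono)
  qed
  have derL2: "L2_norm T (interval_deriv T (\<lambda>t. x k t - xbar t)) \<le> sqrt ((V + speed) * (2 * \<epsilon> k))" if k: "k \<ge> 1" for k
  proof -
    let ?h = "\<lambda>t. v k (cell_index T k t) - ?D t"
    have hm: "?h \<in> borel_measurable (lebesgue_on {0..T})"
      using stepm[of "v k" k] Dm by (intro borel_measurable_diff)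
    have hb: "norm (?h t) \<le> V + speed" if "t \<in> {0..T}" for t
      using norm_triangle_ineq4[of "v k (cell_index T k t)" "?D t"] vV[OF k that] Db[OF that] by linarith
    have "interval_deriv T (\<lambda>t. x k t - xbar t) t = ?h t" if t: "t \<in> {0..T} - (N \<union> ?G k)" for t
    proof (rule interval_deriv_eq[OF T_pos])
      show "((\<lambda>t. x k t - xbar t) has_vector_derivative ?h t) (at t within {0..T})"
        using t by (intro has_vector_derivative_diff xder[OF k] der) auto
    qed (use t in auto)
    then have le: "L2_norm T (interval_deriv T (\<lambda>t. x k t - xbar t)) \<le> sqrt ((V + speed) * integral {0..T} (\<lambda>t. norm (?h t)))"
      using negligible_N negG[of k] by (intro L2_norm_le_L1[OF hm hb, of "N \<union> ?G k"]) auto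
    have int1: "(\<lambda>t. norm (u k (cell_index T k t) - ubar t)) integrable_on {0..T}"
      and int2: "(\<lambda>t. norm (w k (cell_index T k t) - ybar t)) integrable_on {0..T}"
      using set_integral_diff(1)[OF step_absolutely_integrable[OF T_pos k] ubar_integrable]
        set_integral_diff(1)[OF step_absolutely_integrable[OF T_pos k] ybar_integrable]
      by (simp_all add: absolutely_integrable_on_def)
    have hint: "(\<lambda>t. norm (?h t)) integrable_on {0..T}"
      using bounded_measurable_absolutely_integrable[OF hm hb] by (simp add: absolutely_integrable_on_def)
    \<comment> \<open>The velocity error splits into the error of \<open>u k\<close> and that of
      \<open>w k\<close>, each at most \<open>\<epsilon> k\<close> in L1.\<close>
    have "integral {0..T} (\<lambda>t. norm (?h t)) \<le>
        integral {0..T} (\<lambda>t. norm (u k (cell_index T k t) - ubar t) + norm (w k (cell_index T k t) - ybar t))"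
    proof (rule integral_le[OF hint integrable_add[OF int1 int2]])
      show "norm (?h t) \<le> norm (u k (cell_index T k t) - ubar t) + norm (w k (cell_index T k t) - ybar t)" for t
        using norm_triangle_ineq[of "u k (cell_index T k t) - ubar t" "w k (cell_index T k t) - ybar t"]
        by (simp add: v_def algebra_simps)
    qed
    also have "\<dots> \<le> 2 * \<epsilon> k"
      using uL1[OF k] wL1[OF k] by (simp add: integral_add[OF int1 int2])
    finally have "(V + speed) * integral {0..T} (\<lambda>t. norm (?h t)) \<le> (V + speed) * (2 * \<epsilon> k)"
      using V0 speed_nonneg by (intro mult_left_mono) auto
    with le show ?thesis by (meson order_trans real_sqrt_le_mono)
  qed
  have L2_nonneg: "0 \<le> L2_norm T f" for f :: "real \<Rightarrow> real ^ 'n"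
    by (simp add: L2_norm_def)
  have \<epsilon>0: "0 \<le> \<epsilon> k" if "k \<ge> 1" for k
    using order_trans[OF norm_ge_zero nodes[OF that, of 0]] by simp
  have W12_le: "W12_norm T (\<lambda>t. x k t - xbar t) \<le> sqrt (\<delta> k * (\<delta> k * T) + (V + speed) * (2 * \<epsilon> k))" if k: "k \<ge> 1" for k
  proof -
    have "(L2_norm T (\<lambda>t. x k t - xbar t))\<^sup>2 \<le> \<delta> k * (\<delta> k * T)"
      using power_mono[OF posL2[OF k] L2_nonneg, of 2] \<delta>0[OF k] T_pos by simp
    moreover have "(L2_norm T (interval_deriv T (\<lambda>t. x k t - xbar t)))\<^sup>2 \<le> (V + speed) * (2 * \<epsilon> k)"
      using power_mono[OF derL2[OF k] L2_nonneg, of 2] V0 speed_nonneg \<epsilon>0[OF k] by simp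
    ultimately show ?thesis unfolding W12_norm_def by simp
  qed
  have \<delta>: "\<delta> \<longlonglongrightarrow> 0 + (V + speed) * 0"
    unfolding \<delta>_def by (intro tendsto_intros \<epsilon> lim_const_over_n)
  have lim: "(\<lambda>k. sqrt (\<delta> k * (\<delta> k * T) + (V + speed) * (2 * \<epsilon> k))) \<longlonglongrightarrow>
      sqrt ((0 + (V + speed) * 0) * ((0 + (V + speed) * 0) * T) + (V + speed) * (2 * 0))"
    by (intro tendsto_intros \<epsilon> \<delta>)
  have "(\<lambda>k. W12_norm T (\<lambda>t. x k t - xbar t)) \<longlonglongrightarrow> 0"
  proof (rule tendsto_sandwich[OF _ _ tendsto_const])
    show "\<forall>\<^sub>F k in sequentially. 0 \<le> W12_norm T (\<lambda>t. x k t - xbar t)" by (simp add: W12_norm_def)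
    show "\<forall>\<^sub>F k in sequentially. W12_norm T (\<lambda>t. x k t - xbar t) \<le> sqrt (\<delta> k * (\<delta> k * T) + (V + speed) * (2 * \<epsilon> k))"
      \<comment> \<open>Nothing is known about the sequences at \<open>k = 0\<close>.\<close>
      using eventually_ge_at_top[of 1] by eventually_elim (rule W12_le)
  qed (use lim in simp)
  then have W12: "W12_convergence T x xbar"
    using W12x W12xbar by (simp add: W12_convergence_def)
  have yL2: "in_L2 T (y k)" if "k \<ge> 1" for k
    by (rule L2_of_bounded(1)[where h = "\<lambda>t. w k (cell_index T k t)", OF stepm wW[OF that] negligible_sing[of 0]])
       (simp_all add: y_def)
  have ybarL2: "in_L2 T ybar"
    by (rule L2_of_bounded(1)[OF ybar_regular(1) ybar_bound negligible_empty refl])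
  have y_le: "L2_norm T (\<lambda>t. y k t - ybar t) \<le> sqrt ((W + Y) * \<epsilon> k)" if k: "k \<ge> 1" for k
  proof -
    let ?h = "\<lambda>t. w k (cell_index T k t) - ybar t"
    have hb: "norm (?h t) \<le> W + Y" if "t \<in> {0..T}" for t
      using norm_triangle_ineq4[of "w k (cell_index T k t)" "ybar t"] wW[OF k that] ybar_bound[OF that]
      by (simp add: Y_def)
    have hm: "?h \<in> borel_measurable (lebesgue_on {0..T})"
      using stepm[of "w k" k] ybar_regular(1) by (intro borel_measurable_diff)
    have "L2_norm T (\<lambda>t. y k t - ybar t) \<le> sqrt ((W + Y) * integral {0..T} (\<lambda>t. norm (?h t)))"
      by (rule L2_norm_le_L1[OF hm hb negligible_sing[of 0]]) (simp_all add: y_def)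
    also have "\<dots> \<le> sqrt ((W + Y) * \<epsilon> k)"
    proof (rule real_sqrt_le_mono[OF mult_left_mono[OF wL1[OF k]]])
      show "0 \<le> W + Y" using order_trans[OF norm_ge_zero hb[of 0]] T_pos by simp
    qed
    finally show ?thesis .
  qed
  have limy: "(\<lambda>k. sqrt ((W + Y) * \<epsilon> k)) \<longlonglongrightarrow> sqrt ((W + Y) * 0)"
    by (intro tendsto_intros \<epsilon>)
  have "(\<lambda>k. L2_norm T (\<lambda>t. y k t - ybar t)) \<longlonglongrightarrow> 0"
  proof (rule tendsto_sandwich[OF _ _ tendsto_const])
    show "\<forall>\<^sub>F k in sequentially. 0 \<le> L2_norm T (\<lambda>t. y k t - ybar t)" by (simp add: L2_norm_def)
    show "\<forall>\<^sub>F k in sequentially. L2_norm T (\<lambda>t. y k t - ybar t) \<le> sqrt ((W + Y) * \<epsilon> k)"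
      using eventually_ge_at_top[of 1] by eventually_elim (rule y_le)
  qed (use limy in simp)
  then have "L2_convergence T y ybar"
    using yL2 ybarL2 by (simp add: L2_convergence_def)
  with approx W12 show thesis by (rule that)
qed

end

theorem theorem4p1:
  fixes T :: real
    and F :: "real \<Rightarrow> real ^ 'n \<Rightarrow> (real ^ 'n) set"
    and g :: "real \<Rightarrow> real \<Rightarrow> real ^ 'n \<Rightarrow> real ^ 'n"
    and x0 :: "real ^ 'n"
    and xbar :: "real \<Rightarrow> real ^ 'n"
    and \<tau> :: "nat \<Rightarrow> nat \<Rightarrow> real"
  assumes "T > 0"
    and "assumption_F T F"
    and "assumption_g T g"
    and "is_solution T F g x0 xbar"
    and "\<And>k. k \<ge> 1 \<Longrightarrow> is_mesh T k (\<tau> k)"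
  shows "\<exists>(x :: nat \<Rightarrow> real \<Rightarrow> real ^ 'n) (y :: nat \<Rightarrow> real \<Rightarrow> real ^ 'n)
            (v :: nat \<Rightarrow> nat \<Rightarrow> real ^ 'n) (w :: nat \<Rightarrow> nat \<Rightarrow> real ^ 'n).
           (\<forall>k\<ge>1. is_discrete_approximation F g x0 k (\<tau> k) (x k) (y k) (v k) (w k)) \<and>
           W12_convergence T x xbar \<and>
           L2_convergence T y (memory_term g xbar)"
proof -
  obtain m l \<beta> where "scheme_data T m l \<beta> F g"
    using scheme_data_of_assumptions[OF assms(1-3)] .
  then interpret scheme_data T m l \<beta> F g x0 .
  have ac: "abs_continuous_on_interval 0 T xbar" and init: "xbar 0 = x0"
    and ae: "AE t in lebesgue_on {0..T}. \<exists>u\<in>F t (xbar t).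
        (xbar has_vector_derivative (u + memory_term g xbar t)) (at t within {0..T})"
    using assms(4) unfolding is_solution_def by blast+
  have aeF: "AE t in lebesgue_on {0..T}. \<forall>\<epsilon>>0. \<exists>\<delta>>0. \<forall>t'\<in>{0..T}. \<bar>t' - t\<bar> < \<delta> \<longrightarrow>
          (\<forall>x. pompeiu_hausdorff (F t' x) (F t x) < \<epsilon>)"
    using assms(2) unfolding assumption_F_def by blast
  obtain N1 where N1: "negligible N1" "\<And>t. t \<in> {0..T} - N1 \<Longrightarrow> \<exists>u\<in>F t (xbar t).
        (xbar has_vector_derivative (u + memory_term g xbar t)) (at t within {0..T})"
    using AE_lebesgue_on_negligible[OF ae] by blast
  obtain N2 where N2: "negligible N2" "\<And>t. t \<in> {0..T} - N2 \<Longrightarrow> \<forall>\<epsilon>>0. \<exists>\<delta>>0. \<forall>t'\<in>{0..T}. \<bar>t' - t\<bar> < \<delta> \<longrightarrow>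
          (\<forall>x. pompeiu_hausdorff (F t' x) (F t x) < \<epsilon>)"
    using AE_lebesgue_on_negligible[OF aeF] by blast
  define N where "N = N1 \<union> N2"
  \<comment> \<open>A pointwise choice, with no measurability at this stage.\<close>
  obtain u where u: "\<And>t. t \<in> {0..T} - N1 \<Longrightarrow> u t \<in> F t (xbar t) \<and>
        (xbar has_vector_derivative (u t + memory_term g xbar t)) (at t within {0..T})"
    using N1(2) by metis
  \<comment> \<open>The value 0 on the exceptional set keeps the bound \<open>m\<close> valid at
    every time.\<close>
  define ubar where "ubar t = (if t \<in> {0..T} - N then u t else 0)" for t
  have negN: "negligible N" using N1(1) N2(1) by (simp add: N_def)
  have der: "(xbar has_vector_derivative (ubar t + memory_term g xbar t)) (at t within {0..T})" if "t \<in> {0..T} - N" for t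
    using u[of t] that by (auto simp: ubar_def N_def)
  have xc: "continuous_on {0..T} xbar" by (rule abs_continuous_imp_continuous_on[OF ac])
  obtain R where R: "\<And>t. t \<in> {0..T} \<Longrightarrow> norm (xbar t) \<le> R"
    using compact_imp_bounded[OF compact_continuous_image[OF xc compact_Icc]] unfolding bounded_iff by (metis imageI)
  have incr: "((\<lambda>t. ubar t + memory_term g xbar t) has_integral (xbar b - xbar a)) {a..b}"
    if "0 \<le> a" "a \<le> b" "b \<le> T" for a b
  proof (rule abs_continuous_fundamental_theorem[OF abs_continuous_on_subinterval[OF ac that(1,3)] that(2) negN])
    show "(xbar has_vector_derivative (ubar t + memory_term g xbar t)) (at t within {a..b})" if "t \<in> {a..b} - N" for t
      using that \<open>0 \<le> a\<close> \<open>b \<le> T\<close> by (intro has_vector_derivative_within_subset[OF der]) auto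
  qed
  \<comment> \<open>The fundamental theorem makes the derivative integrable, hence measurable;
    subtracting the measurable memory term gives measurability of \<open>ubar\<close>.\<close>
  have "(\<lambda>t. ubar t + memory_term g xbar t) \<in> borel_measurable (lebesgue_on {0..T})"
    using incr[of 0 T] assms(1) by (intro integrable_imp_measurable) (auto simp: integrable_on_def)
  from borel_measurable_diff[OF this memory_term_regular(1)[OF xc R]]
  have um: "ubar \<in> borel_measurable (lebesgue_on {0..T})" by simp
  interpret scheme_solution T m l \<beta> F g x0 xbar ubar N R
  proof
    show "norm (ubar t) \<le> m" if "t \<in> {0..T}" for t
      using F_bound[OF that] u[of t] that m_nonneg by (auto simp: ubar_def N_def)
    show "ubar t \<in> F t (xbar t)" if "t \<in> {0..T} - N" for t
      using u[of t] that by (auto simp: ubar_def N_def)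
    show "\<exists>\<delta>>0. \<forall>t'\<in>{0..T}. \<bar>t' - t\<bar> < \<delta> \<longrightarrow>
          (\<forall>x. (\<forall>a\<in>F t' x. \<exists>b\<in>F t x. norm (a - b) \<le> \<epsilon>) \<and> (\<forall>b\<in>F t x. \<exists>a\<in>F t' x. norm (b - a) \<le> \<epsilon>))"
      if t: "t \<in> {0..T} - N" and \<epsilon>: "\<epsilon> > 0" for t \<epsilon>
    proof -
      obtain \<delta> where \<delta>: "\<delta> > 0" "\<And>t' x. t' \<in> {0..T} \<Longrightarrow> \<bar>t' - t\<bar> < \<delta> \<Longrightarrow> pompeiu_hausdorff (F t' x) (F t x) < \<epsilon>"
        using N2(2)[of t] t \<epsilon> unfolding N_def by blast
      have F3: "F s x \<subseteq> cball 0 m \<and> closed (F s x) \<and> F s x \<noteq> {}" if "s \<in> {0..T}" for s x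
        using F_bound[OF that] F_closed[OF that] F_nonempty[OF that] by auto
      have "(\<forall>a\<in>F t' x. \<exists>b\<in>F t x. norm (a - b) \<le> \<epsilon>) \<and> (\<forall>b\<in>F t x. \<exists>a\<in>F t' x. norm (b - a) \<le> \<epsilon>)"
        if t': "t' \<in> {0..T}" "\<bar>t' - t\<bar> < \<delta>" for t' x
      proof -
        have tT: "t \<in> {0..T}" using t by simp
        note near = pompeiu_hausdorff_near[where m = m, OF _ _ _ _ _ _ \<delta>(2)[OF t'], of x]
        show ?thesis
          using near(1) near(2) F3[OF t'(1), of x] F3[OF tT, of x] by simp
      qed
      with \<delta>(1) show ?thesis by blast
    qed
  qed (use xc R init um negN incr in auto)
  obtain x y v w where
    "\<And>k. k \<ge> 1 \<Longrightarrow> is_discrete_approximation F g x0 k (grid T k) (x k) (y k) (v k) (w k)"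
    and conv: "W12_convergence T x xbar" "L2_convergence T y (memory_term g xbar)"
    using approximation_converges[OF ac der] by blast
  then have "is_discrete_approximation F g x0 k (\<tau> k) (x k) (y k) (v k) (w k)" if "k \<ge> 1" for k
    using is_discrete_approximation_mesh_cong[of k "\<tau> k" "grid T k"] mesh_eq_grid[OF assms(5)[OF that] that] that by blast
  with conv show ?thesis by blast
qed

end
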